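(* Let $W\subset\mathbb{C}^*$ be the group of roots of unity of degree $2$, $3$, $4$ or $6$, and let $p$ be a prime. Let $\Lambda$ be a sublattice of index $p$ in a lattice $\Lambda'\subset\mathbb{C}$, and assume that both $\Lambda$ and $\Lambda'$ are invariant under multiplication by elements of $W$. Let $S_\Lambda$ denote $\wp_\Lambda$, $\wp_\Lambda'$, $\wp_\Lambda''$, $\wp_\Lambda^{(4)}$ when $|W|=2,3,4,6$ respectively, and define $S_{\Lambda'}$ in the same way. Then $S_{\Lambda'}(z)=R(S_\Lambda(z))$, where $R$ is the rational function $$R(w)=(-1)^{|W|}\sum_{0\neq u\in(\Lambda'/\Lambda)/W}\frac{\partial^{|W|}}{\partial u^{|W|}}\log\bigl(S_\Lambda(u)-w\bigr)+w+S_{\Lambda'}[0]-S_\Lambda[0].$$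
   Context: $\wp_\Lambda$ is the Weierstrass $\wp$-function of the lattice $\Lambda$ and $\wp_\Lambda^{(k)}$ its $k$-th derivative. The values $|W|=2,3,4,6$ correspond to the branching cases $(2,2,2,2)$, $(3,3,3)$, $(2,4,4)$, $(2,3,6)$. For a meromorphic function $g$, $g[0]$ denotes the constant term of its Laurent expansion at $0$. The sum is over the $W$-orbits of nonzero elements of $\Lambda'/\Lambda$, with $u$ a representative of the orbit; the derivative is taken with respect to $u$ with $w$ held constant.
   Formalization: The printed R is false: the sign before the sum must be (-1)^{|W|+1}, not (-1)^{|W|}, and the term of each orbit must be divided by the order of the stabilizer in W of the class of u (1 when W acts freely on nonzero classes). The formal theorem uses this corrected R. *)

theory Defs
  imports "HOL-Complex_Analysis.Complex_Analysis" "HOL-Computational_Algebra.Computational_Algebra"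
begin

definition is_lattice :: "complex set \<Rightarrow> bool" where
  "is_lattice L \<longleftrightarrow>
     (\<exists>a b. a \<noteq> 0 \<and> b / a \<notin> \<real> \<and> L = {of_int m * a + of_int n * b | m n. True})"

definition lattice_coset :: "complex set \<Rightarrow> complex \<Rightarrow> complex set" where
  "lattice_coset L u = (\<lambda>l. u + l) ` L"

definition lattice_index :: "complex set \<Rightarrow> complex set \<Rightarrow> nat" where
  "lattice_index L L' = card (lattice_coset L ` L')"

definition invariant_under :: "complex set \<Rightarrow> complex set \<Rightarrow> bool" where
  "invariant_under W L \<longleftrightarrow> (\<forall>\<zeta>\<in>W. \<forall>x\<in>L. \<zeta> * x \<in> L)"

definition weierstrass_p :: "complex set \<Rightarrow> complex \<Rightarrow> complex" where
  "weierstrass_p L z = 1 / z ^ 2 + (\<Sum>\<^sub>\<infinity>l\<in>L - {0}. 1 / (z - l) ^ 2 - 1 / l ^ 2)"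

text \<open>For \<open>|W| = 2, 3, 4, 6\<close> the order of the derivative is \<open>0, 1, 2, 4\<close>.\<close>
definition S_fun :: "complex set \<Rightarrow> complex set \<Rightarrow> complex \<Rightarrow> complex" where
  "S_fun W L = (deriv ^^ (card W - 2)) (weierstrass_p L)"

definition constant_term :: "(complex \<Rightarrow> complex) \<Rightarrow> complex" where
  "constant_term g = fls_nth (laurent_expansion g 0) 0"

text \<open>
  The principal branch \<^const>\<open>Ln\<close> is discontinuous along the negative real axis, so
  \<open>Ln \<circ> f\<close> need not be differentiable at \<open>u\<close>. The following branch of \<open>log f\<close> is
  holomorphic near \<open>u\<close> whenever \<open>f\<close> is and \<open>f u \<noteq> 0\<close>; all branches have the same derivatives.
\<close>
definition log_near :: "(complex \<Rightarrow> complex) \<Rightarrow> complex \<Rightarrow> complex \<Rightarrow> complex" where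
  "log_near f u v = Ln (f u) + Ln (f v / f u)"

lemma exp_log_near: "f u \<noteq> 0 \<Longrightarrow> f v \<noteq> 0 \<Longrightarrow> exp (log_near f u v) = f v"
  by (simp add: log_near_def exp_add)

lemma log_near_analytic:
  assumes "f analytic_on {u}" "f u \<noteq> 0"
  shows "log_near f u analytic_on {u}"
  unfolding log_near_def using assms by (auto intro!: analytic_intros)

text \<open>The orbit of the class of \<open>u\<close> in \<open>L'/L\<close>, as the union of the cosets belonging to it.\<close>
definition orbit_class :: "complex set \<Rightarrow> complex set \<Rightarrow> complex \<Rightarrow> complex set" where
  "orbit_class W L u = (\<Union>\<zeta>\<in>W. lattice_coset L (\<zeta> * u))"

definition nonzero_orbits :: "complex set \<Rightarrow> complex set \<Rightarrow> complex set \<Rightarrow> complex set set" where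
  "nonzero_orbits W L L' = orbit_class W L ` (L' - L)"

definition class_stabilizer :: "complex set \<Rightarrow> complex set \<Rightarrow> complex \<Rightarrow> complex set" where
  "class_stabilizer W L u = {\<zeta> \<in> W. lattice_coset L (\<zeta> * u) = lattice_coset L u}"

text \<open>
  \<open>rep\<close> picks a representative of each orbit. Two points need care.

  The sign in front of the sum has to be \<open>(-1)\<close> to the power \<open>|W| + 1\<close>, not \<open>|W|\<close>. For
  \<open>w = S z\<close> the function \<open>S u - w\<close> of \<open>u\<close> has a pole of order \<open>|W|\<close> at \<open>0\<close> and zeros at
  the points \<open>\<zeta> * z\<close>, so the derivative of order \<open>|W|\<close> of its logarithm is
  \<open>|W| * S u - (\<Sum>\<zeta>\<in>W. S (u - \<zeta> * z))\<close>, where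
  \<open>S (u - \<zeta> * z) = (-1) ^ |W| * S (z - u / \<zeta>)\<close>; but the average of \<open>S\<close> over \<open>L'/L\<close>
  contains \<open>S (z - u)\<close> with coefficient \<open>+1\<close>.

  The orbit sum is taken in the quotient by the group action with multiplicities: an orbit
  counts with weight \<open>1/|Stab u|\<close>. The weights are \<open>1\<close> if the action on the nonzero classes
  is free; it is not free exactly for \<open>p = 2\<close> with \<open>|W| = 2, 4\<close> and \<open>p = 3\<close> with
  \<open>|W| = 3, 6\<close>.
\<close>
definition R_fun ::
  "complex set \<Rightarrow> complex set \<Rightarrow> complex set \<Rightarrow> (complex set \<Rightarrow> complex) \<Rightarrow> complex \<Rightarrow> complex" where
  "R_fun W L L' rep w =
     (- 1) ^ (card W + 1) *
       (\<Sum>A\<in>nonzero_orbits W L L'.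
          (deriv ^^ card W) (log_near (\<lambda>v. S_fun W L v - w) (rep A)) (rep A)
            / of_nat (card (class_stabilizer W L (rep A))))
     + w + constant_term (S_fun W L') - constant_term (S_fun W L)"

end

theory Submission
  imports Defs
begin

text \<open>
  \<open>S\<close> is elliptic, invariant under \<open>W\<close>, and its only pole modulo \<open>L\<close> has order \<open>|W|\<close>. Hence the
  zeros of \<open>S v - S z\<close> are the points \<open>\<zeta> * z\<close>, and comparing poles and using Liouville's theorem gives
  \<open>\<partial>\<^sup>m log (S v - S z) = m * S v - (\<Sum>\<zeta>\<in>W. S (v - \<zeta> * z))\<close> for \<open>m = |W|\<close>: the difference of the two
  sides does not depend on \<open>v\<close>, so that it is entire and elliptic in \<open>z\<close>, and it tends to \<open>0\<close> with \<open>z\<close>.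
  On the other hand \<open>S'\<close>, the function of \<open>L'\<close>, differs by a constant from the sum of the translates
  of \<open>S\<close> by \<open>L' / L\<close>; grouping these into orbits turns them into the logarithmic derivatives.

  No contour integral is needed to count the zeros of \<open>S v - S z\<close>. The set of \<open>z\<close> whose fibre is larger
  than the orbit of \<open>z\<close> is open by the open mapping theorem, relatively closed off the critical fibres,
  and misses the points near \<open>0\<close>, where \<open>S\<close> is the inverse \<open>m\<close>-th power of a local coordinate.
  The complement of the countably many points in critical fibres is connected, so the set is empty.
\<close>

text \<open>The order \<open>m - 2\<close> of the derivative lets poles be compared through a single
  coefficient. The principal part of \<open>S\<close> is \<open>c / z ^ m\<close> with
  \<open>c = (- 1) ^ m * fact (m - 1)\<close> and no lower terms, and \<open>m - 1\<close>
  derivatives of \<open>s / (v - a)\<close> give \<open>- s * c / (v - a) ^ m\<close>. So the order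
  \<open>- m\<close> of \<open>S v - S z\<close> at a lattice point yields the principal part of
  \<open>m * S\<close>, and a simple zero at \<open>\<zeta> * z\<close> yields minus that of
  \<open>S (v - \<zeta> * z)\<close>. This comparison in \<open>v\<close> needs simple zeros that
  are distinct modulo \<open>L\<close>, so it covers generic \<open>z\<close> only, and it leaves an
  unknown constant for each such \<open>z\<close>. The second argument, in \<open>z\<close>,
  evaluates it: when \<open>z\<close> tends to 0, \<open>S z\<close> tends to infinity, the
  logarithmic term dies out and the \<open>m\<close> translates add up to \<open>m * S v\<close>. In
  the study of the fibres, critical values are the obstacle: over them a further preimage may merge
  in the limit with the orbit of \<open>z\<close>, so that a limit of bad points need not be
  bad.\<close>

subsection \<open>Removable singularities\<close>

text \<open>The value of \<open>h\<close> at \<open>a\<close> is ignored because division by zero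
  makes it arbitrary there, as in \<open>S z - c / z ^ m\<close> at 0. Stability under sums, affine
  substitutions and derivatives lets principal parts be cancelled one at a time.\<close>

definition removable_at :: "(complex \<Rightarrow> complex) \<Rightarrow> complex \<Rightarrow> bool" where
  "removable_at h a \<longleftrightarrow> (\<exists>r. r analytic_on {a} \<and> (\<forall>\<^sub>F z in at a. h z = r z))"

lemma removable_atI:
  assumes "r analytic_on {a}" "\<forall>\<^sub>F z in at a. h z = r z"
  shows "removable_at h a"
  using assms unfolding removable_at_def by blast

lemma removable_at_analytic: "h analytic_on {a} \<Longrightarrow> removable_at h a"
  by (rule removable_atI) auto

lemma removable_at_cong:
  assumes "removable_at g a" "\<forall>\<^sub>F z in at a. h z = g z"
  shows "removable_at h a"
proof -
  obtain r where "r analytic_on {a}" "\<forall>\<^sub>F z in at a. g z = r z"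
    using assms(1) unfolding removable_at_def by blast
  thus ?thesis using assms(2)
    by (auto intro!: removable_atI[of r] elim: eventually_elim2)
qed

lemma removable_at_add:
  assumes "removable_at f a" "removable_at g a"
  shows "removable_at (\<lambda>z. f z + g z) a"
proof -
  obtain r s where "r analytic_on {a}" "\<forall>\<^sub>F z in at a. f z = r z"
    "s analytic_on {a}" "\<forall>\<^sub>F z in at a. g z = s z"
    using assms unfolding removable_at_def by blast
  thus ?thesis
    by (auto intro!: removable_atI[of "\<lambda>z. r z + s z"] analytic_intros elim: eventually_elim2)
qed

lemma removable_at_cmult:
  assumes "removable_at f a"
  shows "removable_at (\<lambda>z. c * f z) a"
proof -
  obtain r where "r analytic_on {a}" "\<forall>\<^sub>F z in at a. f z = r z"
    using assms unfolding removable_at_def by blast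
  thus ?thesis
    by (auto intro!: removable_atI[of "\<lambda>z. c * r z"] analytic_intros elim: eventually_mono)
qed

lemma removable_at_diff:
  assumes "removable_at f a" "removable_at g a"
  shows "removable_at (\<lambda>z. f z - g z) a"
  using removable_at_add[OF assms(1) removable_at_cmult[OF assms(2), of "-1"]] by simp

lemma eventually_at_affine:
  fixes u c :: complex
  assumes "u \<noteq> 0" "\<forall>\<^sub>F z in at (u * a + c). P z"
  shows "\<forall>\<^sub>F z in at a. P (u * z + c)"
proof -
  have "filterlim (\<lambda>z. u * z + c) (at (u * a + c)) (at a)"
    by (rule filterlim_atI) (use assms(1) in \<open>auto intro!: tendsto_intros simp: eventually_at_filter\<close>)
  thus ?thesis using assms(2) by (rule eventually_compose_filterlim[rotated])
qed

lemma removable_at_affine: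
  assumes "u \<noteq> 0" "removable_at h (u * a + c)"
  shows "removable_at (\<lambda>z. h (u * z + c)) a"
proof -
  obtain r where r: "r analytic_on {u * a + c}" "\<forall>\<^sub>F z in at (u * a + c). h z = r z"
    using assms unfolding removable_at_def by blast
  have "(r \<circ> (\<lambda>z. u * z + c)) analytic_on {a}"
    by (rule analytic_on_compose) (use r in \<open>auto intro!: analytic_intros\<close>)
  thus ?thesis using eventually_at_affine[OF assms(1) r(2)]
    by (auto intro!: removable_atI[of "r \<circ> (\<lambda>z. u * z + c)"])
qed

text \<open>A punctured neighbourhood is open, so an identity on it also holds near each of its
  points. This is what permits differentiating such an identity.\<close>

lemma eventually_at_eventually_nhds:
  fixes a :: "'a :: t1_space"
  assumes "\<forall>\<^sub>F z in at a. P z"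
  shows "\<forall>\<^sub>F z in at a. \<forall>\<^sub>F w in nhds z. P w"
proof -
  obtain S where S: "open S" "a \<in> S" "\<And>z. z \<in> S \<Longrightarrow> z \<noteq> a \<Longrightarrow> P z"
    using assms unfolding eventually_at_topological by blast
  have "open (S - {a})" using S by auto
  hence "\<forall>\<^sub>F w in nhds z. P w" if "z \<in> S" "z \<noteq> a" for z
    using S(3) that unfolding eventually_nhds by (intro exI[of _ "S - {a}"]) auto
  thus ?thesis using S unfolding eventually_at_topological by blast
qed

lemma removable_at_deriv:
  assumes "removable_at h a"
  shows "removable_at (deriv h) a"
proof -
  obtain r where r: "r analytic_on {a}" "\<forall>\<^sub>F z in at a. h z = r z"
    using assms unfolding removable_at_def by blast
  have "\<forall>\<^sub>F z in at a. deriv h z = deriv r z"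
    using eventually_at_eventually_nhds[OF r(2)]
    by eventually_elim (auto intro: deriv_cong_ev)
  thus ?thesis using analytic_deriv[OF r(1)] by (rule removable_atI[rotated])
qed

lemma removable_at_higher_deriv: "removable_at h a \<Longrightarrow> removable_at ((deriv ^^ n) h) a"
  by (induction n) (auto intro: removable_at_deriv)

lemma removable_at_tendsto:
  assumes "removable_at h a"
  obtains l where "h \<midarrow>a\<rightarrow> l"
proof -
  obtain r where r: "r analytic_on {a}" "\<forall>\<^sub>F z in at a. h z = r z"
    using assms unfolding removable_at_def by blast
  have "r \<midarrow>a\<rightarrow> r a" using analytic_at_imp_isCont[OF r(1)] by (simp add: isCont_def)
  hence "h \<midarrow>a\<rightarrow> r a" using r(2) by (subst filterlim_cong) auto
  thus ?thesis by (rule that)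
qed

lemma remove_sings_analytic_of_removable:
  assumes "removable_at h a"
  shows "remove_sings h analytic_on {a}"
proof -
  obtain r where r: "r analytic_on {a}" "\<forall>\<^sub>F z in at a. h z = r z"
    using assms unfolding removable_at_def by blast
  obtain e where e: "e > 0" "r holomorphic_on ball a e" 
    using r(1) analytic_at_ball by blast
  obtain d where d: "d > 0" "\<And>z. z \<noteq> a \<Longrightarrow> dist z a < d \<Longrightarrow> h z = r z"
    using r(2) unfolding eventually_at by blast
  have eq: "remove_sings h w = r w" if "w \<in> ball a (min d e)" for w
  proof -
    \<comment> \<open>\<open>remove_sings\<close> acts at every point of the ball, so
      \<open>h\<close> and \<open>r\<close> have to agree around each \<open>w\<close>, not only
      around \<open>a\<close>.\<close>
    have "\<forall>\<^sub>F z in at w. z \<in> ball a (min d e) - {a}"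
    proof (cases "w = a")
      case True thus ?thesis
        using d e eventually_at_in_open[of "ball a (min d e)" a] by simp
    next
      case False thus ?thesis using that by (intro eventually_at_in_open') auto
    qed
    hence "\<forall>\<^sub>F z in at w. h z = r z"
      by eventually_elim (auto intro!: d simp: dist_commute)
    hence "remove_sings h w = remove_sings r w" by (intro remove_sings_cong) auto
    also have "\<dots> = r w"
      using that e by (intro remove_sings_at_analytic holomorphic_on_imp_analytic_at[of _ "ball a e"]) auto
    finally show ?thesis .
  qed
  have "r holomorphic_on ball a (min d e)"
    by (rule holomorphic_on_subset[OF e(2)]) auto
  hence "remove_sings h holomorphic_on ball a (min d e)"
    by (rule holomorphic_transform) (simp add: eq)
  thus ?thesis using d e by (auto simp: analytic_at intro!: exI[of _ "ball a (min d e)"])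
qed

subsection \<open>Lattices\<close>

lemma lattice_coordinates:
  assumes "(a::complex) \<noteq> 0" "b / a \<notin> \<real>"
  obtains s t where "z = of_real s * a + of_real t * b"
proof -
  have im: "Im (b / a) \<noteq> 0" using assms complex_is_Real_iff by blast
  define t where "t = Im (z / a) / Im (b / a)"
  define s where "s = Re (z / a) - t * Re (b / a)"
  have "y = of_real (Re y - Im y / Im q * Re q) + of_real (Im y / Im q) * q"
    if "Im q \<noteq> 0" for y q
    unfolding complex_eq_iff using that by simp
  from this[of "b / a" "z / a"] have "z / a = of_real s + of_real t * (b / a)"
    using im unfolding s_def t_def by blast
  hence "z = of_real s * a + of_real t * b" using assms(1) by (simp add: field_simps)
  thus ?thesis by (rule that)
qed

text \<open>After division by \<open>a\<close> the basis is \<open>1\<close>, \<open>b / a\<close>;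
  the imaginary part bounds \<open>t\<close>, and the triangle inequality then bounds
  \<open>s\<close>. The estimate makes the lattice points in a disc finite in number and controls
  the lattice sum.\<close>

lemma lattice_norm_bound:
  assumes "(a::complex) \<noteq> 0" "b / a \<notin> \<real>"
  obtains C where "C > 0"
    "\<And>s t. \<bar>s\<bar> \<le> C * norm (of_real s * a + of_real t * b)"
    "\<And>s t. \<bar>t\<bar> \<le> C * norm (of_real s * a + of_real t * b)"
proof -
  have im: "Im (b / a) \<noteq> 0" using assms complex_is_Real_iff by blast
  define C1 where "C1 = 1 / (\<bar>Im (b / a)\<bar> * norm a)"
  define C2 where "C2 = 1 / norm a + C1 * norm (b / a)"
  have C1: "C1 > 0" using im assms by (simp add: C1_def)
  have t: "\<bar>t\<bar> \<le> C1 * norm (of_real s * a + of_real t * b)" for s t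
  proof -
    have "(of_real s * a + of_real t * b) / a = of_real s + of_real t * (b / a)"
      using assms by (simp add: field_simps)
    moreover have "\<bar>Im (of_real s + of_real t * q)\<bar> = \<bar>t\<bar> * \<bar>Im q\<bar>" for q
      by (simp add: abs_mult)
    ultimately have "\<bar>t\<bar> * \<bar>Im (b / a)\<bar> = \<bar>Im ((of_real s * a + of_real t * b) / a)\<bar>"
      by metis
    also have "\<dots> \<le> norm (of_real s * a + of_real t * b) / norm a"
      using abs_Im_le_cmod norm_divide by metis
    finally show ?thesis using im assms by (simp add: C1_def field_simps)
  qed
  have s: "\<bar>s\<bar> \<le> C2 * norm (of_real s * a + of_real t * b)" for s t
  proof -
    let ?z = "of_real s * a + of_real t * b"
    have "of_real s = ?z / a - of_real t * (b / a)"
      using assms by (simp add: field_simps)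
    hence "\<bar>s\<bar> \<le> norm (?z / a) + norm (of_real t * (b / a))"
      by (metis norm_of_real norm_triangle_ineq4)
    also have "\<dots> = norm ?z / norm a + \<bar>t\<bar> * norm (b / a)"
      by (simp only: norm_divide norm_mult norm_of_real)
    also have "\<dots> \<le> norm ?z / norm a + (C1 * norm ?z) * norm (b / a)"
      by (intro add_left_mono mult_right_mono t) auto
    finally show ?thesis by (simp add: C2_def field_simps)
  qed
  have C2: "C2 > 0" using C1 assms by (auto simp: C2_def intro!: add_pos_nonneg)
  define C where "C = max C1 C2"
  show ?thesis
  proof (rule that[of C])
    show "C > 0" using C1 by (simp add: C_def)
    show "\<bar>s\<bar> \<le> C * norm (of_real s * a + of_real t * b)" for s t
      by (rule order_trans[OF s[of s t]]) (auto simp: C_def intro!: mult_right_mono)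
    show "\<bar>t\<bar> \<le> C * norm (of_real s * a + of_real t * b)" for s t
      by (rule order_trans[OF t[of t s]]) (auto simp: C_def intro!: mult_right_mono)
  qed
qed

lemma lattice_0: "is_lattice L \<Longrightarrow> 0 \<in> L"
  unfolding is_lattice_def by clarify (rule exI[of _ 0], rule exI[of _ 0], simp)

lemma lattice_add: "is_lattice L \<Longrightarrow> x \<in> L \<Longrightarrow> y \<in> L \<Longrightarrow> x + y \<in> L"
  unfolding is_lattice_def
proof clarify
  fix a b :: complex and m n m' n'
  show "\<exists>k l. of_int m * a + of_int n * b + (of_int m' * a + of_int n' * b)
          = of_int k * a + of_int l * b \<and> True"
    by (rule exI[of _ "m + m'"], rule exI[of _ "n + n'"]) (simp add: algebra_simps)
qed

lemma lattice_minus: "is_lattice L \<Longrightarrow> x \<in> L \<Longrightarrow> - x \<in> L"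
  unfolding is_lattice_def
proof clarify
  fix a b :: complex and m n
  show "\<exists>k l. - (of_int m * a + of_int n * b) = of_int k * a + of_int l * b \<and> True"
    by (rule exI[of _ "- m"], rule exI[of _ "- n"]) (simp add: algebra_simps)
qed

lemma lattice_minus_iff: "is_lattice L \<Longrightarrow> - x \<in> L \<longleftrightarrow> x \<in> L"
  using lattice_minus[of L x] lattice_minus[of L "- x"] by auto

lemma lattice_diff: "is_lattice L \<Longrightarrow> x \<in> L \<Longrightarrow> y \<in> L \<Longrightarrow> x - y \<in> L"
  using lattice_add[of L x "- y"] lattice_minus by simp

lemma lattice_add_iff: "is_lattice L \<Longrightarrow> y \<in> L \<Longrightarrow> x + y \<in> L \<longleftrightarrow> x \<in> L"
  using lattice_add[of L x y] lattice_diff[of L "x + y" y] by auto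

lemma lattice_diff_commute: "is_lattice L \<Longrightarrow> x - y \<in> L \<longleftrightarrow> y - x \<in> L"
  using lattice_minus_iff[of L "x - y"] by simp

lemma lattice_fundamental:
  assumes "is_lattice L"
  obtains K where "compact K" "\<And>z. \<exists>l\<in>L. z + l \<in> K"
proof -
  obtain a b where ab: "a \<noteq> 0" "b / a \<notin> \<real>" "L = {of_int m * a + of_int n * b | m n. True}"
    using assms unfolding is_lattice_def by blast
  define K where "K = (\<lambda>(s,t). of_real s * a + of_real t * b) ` (cbox (0::real, 0::real) (1,1))"
  have "compact K" unfolding K_def
    by (rule compact_continuous_image)
       (auto simp: case_prod_beta intro!: continuous_intros compact_cbox)
  moreover have "\<exists>l\<in>L. z + l \<in> K" for z
  proof -
    obtain s t where z: "z = of_real s * a + of_real t * b"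
      using lattice_coordinates[OF ab(1,2)] by blast
    have "of_int (- \<lfloor>s\<rfloor>) * a + of_int (- \<lfloor>t\<rfloor>) * b \<in> L"
      using ab(3) by blast
    moreover have "z + (of_int (- \<lfloor>s\<rfloor>) * a + of_int (- \<lfloor>t\<rfloor>) * b)
      = of_real (frac s) * a + of_real (frac t) * b"
      by (simp add: z frac_def algebra_simps)
    moreover have "\<dots> \<in> K" unfolding K_def
      by (rule image_eqI[of _ _ "(frac s, frac t)"])
         (auto simp: cbox_Pair_eq frac_lt_1 less_imp_le)
    ultimately show ?thesis by metis
  qed
  ultimately show ?thesis by (rule that)
qed

lemma lattice_finite_ball:
  assumes "is_lattice L"
  shows "finite {l \<in> L. norm l \<le> R}"
proof -
  obtain a b where ab: "a \<noteq> 0" "b / a \<notin> \<real>" "L = {of_int m * a + of_int n * b | m n. True}"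
    using assms unfolding is_lattice_def by blast
  obtain C where C: "C > 0"
    "\<And>s t. \<bar>s\<bar> \<le> C * norm (of_real s * a + of_real t * b)"
    "\<And>s t. \<bar>t\<bar> \<le> C * norm (of_real s * a + of_real t * b)"
    using lattice_norm_bound[OF ab(1,2)] by blast
  define N where "N = \<lceil>C * R\<rceil>"
  have "{l \<in> L. norm l \<le> R} \<subseteq> (\<lambda>(m,n). of_int m * a + of_int n * b) ` ({-N..N} \<times> {-N..N})"
  proof
    fix l assume "l \<in> {l \<in> L. norm l \<le> R}"
    then obtain m n where l: "l = of_int m * a + of_int n * b" "norm l \<le> R"
      using ab(3) by blast
    have "\<bar>real_of_int m\<bar> \<le> C * norm l" "\<bar>real_of_int n\<bar> \<le> C * norm l"
      using C(2)[of "of_int m" "of_int n"] C(3)[of "of_int n" "of_int m"] by (simp_all add: l(1))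
    moreover have "C * norm l \<le> C * R" using l C by simp
    ultimately have "\<bar>real_of_int m\<bar> \<le> C * R" "\<bar>real_of_int n\<bar> \<le> C * R" by linarith+
    hence "\<bar>m\<bar> \<le> N" "\<bar>n\<bar> \<le> N" unfolding N_def by linarith+
    thus "l \<in> (\<lambda>(m,n). of_int m * a + of_int n * b) ` ({-N..N} \<times> {-N..N})"
      by (intro image_eqI[of _ _ "(m, n)"]) (auto simp: l(1))
  qed
  thus ?thesis by (rule finite_subset) auto
qed

lemma lattice_sparse:
  assumes "is_lattice L"
  shows "L sparse_in UNIV"
  unfolding sparse_in_eventually_iff[OF open_UNIV]
proof
  fix y :: complex
  have fin: "finite {l \<in> L. norm l \<le> norm y + 1}" by (rule lattice_finite_ball[OF assms])
  have "\<forall>\<^sub>F z in at y. z \<in> ball y 1 - {y}" by (rule eventually_at_in_open) auto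
  moreover have "\<forall>\<^sub>F z in at y. z \<in> - ({l \<in> L. norm l \<le> norm y + 1} - {y}) - {y}"
    by (rule eventually_at_in_open) (use fin in \<open>auto intro: finite_imp_closed simp del: Compl_Diff_eq\<close>)
  ultimately show "\<forall>\<^sub>F z in at y. z \<notin> L"
  proof eventually_elim
    case (elim z)
    have "norm z \<le> norm y + 1"
      using elim(1) norm_triangle_ineq2[of z y] by (auto simp: dist_norm norm_minus_commute)
    thus ?case using elim(2) by auto
  qed
qed

lemma lattice_closed: "is_lattice L \<Longrightarrow> closed L"
  using lattice_sparse sparse_in_UNIV_imp_closed by blast

lemma lattice_open_compl: "is_lattice L \<Longrightarrow> open (- L)"
  using lattice_closed by auto

lemma lattice_eventually: "is_lattice L \<Longrightarrow> \<forall>\<^sub>F z in at y. z \<notin> L"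
  using lattice_sparse sparse_in_eventually_iff[OF open_UNIV] by blast

lemma lattice_connected_compl:
  assumes "is_lattice L"
  shows "connected (- L)"
  using sparse_imp_connected[of UNIV L] lattice_sparse[OF assms]
  by (auto simp: Compl_eq_Diff_UNIV)

lemma lattice_countable: "is_lattice L \<Longrightarrow> countable L"
  using sparse_imp_countable[of UNIV L] lattice_sparse by auto

text \<open>
  Periodicity is only required near each point: the values of \<open>h\<close> on the discrete set of its
  singularities are junk.
\<close>

lemma periodic_removable_constant:
  assumes L: "is_lattice L"
    and rem: "\<And>a. removable_at h a"
    and per: "\<And>a l. l \<in> L \<Longrightarrow> \<forall>\<^sub>F z in at a. h (z + l) = h z"
  obtains c where "\<And>a. h \<midarrow>a\<rightarrow> c"
proof -
  define H where "H = remove_sings h"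
  have an: "H analytic_on {a}" for a
    unfolding H_def by (rule remove_sings_analytic_of_removable[OF rem])
  hence hol: "H holomorphic_on UNIV"
    by (metis analytic_imp_holomorphic analytic_on_analytic_at)
  have H_per: "H (a + l) = H a" if "l \<in> L" for a l
  proof -
    have "H (a + l) = remove_sings (h \<circ> (\<lambda>z. z + l)) a"
      unfolding H_def using filtermap_at_shift[of "- l" a]
      by (intro remove_sings_compose[symmetric]) simp
    also have "\<dots> = H a"
      unfolding H_def by (rule remove_sings_cong) (use per[OF that] in auto)
    finally show ?thesis .
  qed
  obtain K where K: "compact K" "\<And>z. \<exists>l\<in>L. z + l \<in> K" 
    using lattice_fundamental[OF L] by blast
  have "range H \<subseteq> H ` K"
  proof safe
    fix z
    obtain l where "l \<in> L" "z + l \<in> K" using K(2) by blast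
    thus "H z \<in> H ` K" using H_per by (metis image_eqI)
  qed
  moreover have "compact (H ` K)"
    by (rule compact_continuous_image[OF _ K(1)])
       (rule holomorphic_on_imp_continuous_on[OF holomorphic_on_subset[OF hol]], simp)
  ultimately have "bounded (range H)" 
    using bounded_subset compact_imp_bounded by blast
  then obtain c where c: "\<And>z. H z = c"
    using Liouville_theorem[OF hol] unfolding constant_on_def by auto
  show ?thesis
  proof (rule that)
    fix a
    obtain l where l: "h \<midarrow>a\<rightarrow> l" using removable_at_tendsto[OF rem] by blast
    hence "H a = l" unfolding H_def by (rule remove_sings_eqI)
    thus "h \<midarrow>a\<rightarrow> c" using l c by simp
  qed
qed

section \<open>Convergence of the cubic lattice sum\<close>

lemma summable_on_int_inverse_powr: "(\<lambda>n::int. (1 + \<bar>real_of_int n\<bar>) powr (- 3/2)) summable_on UNIV"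
proof -
  have "summable (\<lambda>n::nat. real n powr (-3/2))"
    by (simp add: summable_real_powr_iff)
  hence "summable (\<lambda>n::nat. real (Suc n) powr (-3/2))"
    by (subst summable_Suc_iff)
  hence *: "(\<lambda>n::nat. (1 + real n) powr (-3/2)) summable_on UNIV"
    by (intro norm_summable_imp_summable_on) (simp add: add.commute)
  have 1: "(\<lambda>n::int. (1 + \<bar>real_of_int n\<bar>) powr (- 3/2)) summable_on range int"
    by (subst summable_on_reindex) (use * in \<open>auto simp: o_def\<close>)
  have 2: "(\<lambda>n::int. (1 + \<bar>real_of_int n\<bar>) powr (- 3/2)) summable_on range (\<lambda>n. - int n)"
    by (subst summable_on_reindex) (use * in \<open>auto simp: o_def inj_on_def\<close>)
  have "n \<in> range int \<union> range (\<lambda>n. - int n)" for n :: int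
    by (cases n rule: int_cases2) auto
  hence "UNIV = range int \<union> (range (\<lambda>n. - int n))" by auto
  thus ?thesis using summable_on_union[OF 1 2] by simp
qed

text \<open>The sum is compared with a product of two one-dimensional series. With \<open>M\<close>
  the larger coordinate in absolute value, \<open>1 + M\<close> is bounded by a multiple of the
  norm, and half of the exponent 3 goes to each coordinate; 3/2 exceeds 1, so both series
  converge.\<close>

lemma lattice_summable_cube:
  assumes "is_lattice L"
  shows "(\<lambda>l. 1 / norm l ^ 3) summable_on (L - {0})"
proof -
  obtain a b where ab: "a \<noteq> 0" "b / a \<notin> \<real>" "L = {of_int m * a + of_int n * b | m n. True}"
    using assms unfolding is_lattice_def by blast
  obtain C where C: "C > 0"
    "\<And>s t. \<bar>s\<bar> \<le> C * norm (of_real s * a + of_real t * b)"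
    "\<And>s t. \<bar>t\<bar> \<le> C * norm (of_real s * a + of_real t * b)"
    using lattice_norm_bound[OF ab(1,2)] by blast
  define g where "g = (\<lambda>n::int. (1 + \<bar>real_of_int n\<bar>) powr (- 3/2))"
  define e where "e = (\<lambda>(m::int,n::int). of_int m * a + of_int n * b)"
  have gsum: "g summable_on UNIV" unfolding g_def by (rule summable_on_int_inverse_powr)
  have gpos: "g n \<ge> 0" for n by (simp add: g_def)
  have "(\<lambda>x. case x of (m, n) \<Rightarrow> g m * g n) summable_on UNIV \<times> UNIV"
  proof -
    have "(\<lambda>x. norm (case x of (m, n) \<Rightarrow> g m * g n)) summable_on UNIV \<times> UNIV"
      unfolding Infinite_Sum.abs_summable_on_Sigma_iff using gsum gpos
      by (auto simp: abs_mult infsum_cmult_right' infsum_nonneg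
          intro!: summable_on_cmult_left summable_on_cmult_right)
    thus ?thesis by (rule Infinite_Sum.abs_summable_summable)
  qed
  \<comment> \<open>\<open>8 * C ^ 3\<close> is the cube of \<open>2 * C\<close>, which comes from
    combining \<open>1 + M \<le> 2 * M\<close>, valid for \<open>M \<ge> 1\<close>, with
    \<open>M \<le> C * norm (e x)\<close>.\<close>
  hence s: "(\<lambda>x. 8 * C ^ 3 * (case x of (m, n) \<Rightarrow> g m * g n)) summable_on (UNIV - {(0,0)})"
    by (intro summable_on_cmult_right) (auto elim: summable_on_subset_banach)
  have "(\<lambda>x. 1 / norm (e x) ^ 3) summable_on (UNIV - {(0,0)})"
  proof (rule summable_on_comparison_test[OF s])
    fix x :: "int \<times> int" assume x: "x \<in> UNIV - {(0,0)}"
    obtain m n where mn: "x = (m, n)" by fastforce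
    define M where "M = max \<bar>real_of_int m\<bar> \<bar>real_of_int n\<bar>"
    have M1: "M \<ge> 1" using x mn by (auto simp: M_def)
    have "M \<le> C * norm (e x)"
      using C(2)[of "of_int m" "of_int n"] C(3)[of "of_int n" "of_int m"]
      by (simp add: mn M_def e_def)
    hence le: "1 + M \<le> 2 * C * norm (e x)" using M1 by linarith
    have ne: "norm (e x) > 0" using le M1 C(1) by (smt (verit) mult_nonneg_nonpos norm_ge_zero mult_zero_right)
    have "g m * g n \<ge> (1 + M) powr (-3/2) * (1 + M) powr (-3/2)"
      unfolding g_def by (intro mult_mono powr_mono2') (auto simp: M_def)
    also have "(1 + M) powr (-3/2) * (1 + M) powr (-3/2) = (1 + M) powr (-3)"
      by (simp add: powr_add[symmetric])
    also have "\<dots> = 1 / (1 + M) ^ 3"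
      using M1 by (simp add: powr_minus powr_realpow' divide_inverse)
    finally have "1 / (1 + M) ^ 3 \<le> g m * g n" .
    moreover have "1 / (2 * C * norm (e x)) ^ 3 \<le> 1 / (1 + M) ^ 3"
      using le M1 by (intro divide_left_mono power_mono mult_pos_pos zero_less_power) (use ne C(1) in auto)
    ultimately have "1 / (2 * C * norm (e x)) ^ 3 \<le> g m * g n" by linarith
    hence "8 * C ^ 3 * (1 / (2 * C * norm (e x)) ^ 3) \<le> 8 * C ^ 3 * (g m * g n)"
      using C(1) by (intro mult_left_mono) auto
    moreover have "8 * C ^ 3 * (1 / (2 * C * norm (e x)) ^ 3) = 1 / norm (e x) ^ 3"
      using C(1) ne by (simp add: power_mult_distrib field_simps)
    ultimately show "1 / norm (e x) ^ 3 \<le> 8 * C ^ 3 * (case x of (m, n) \<Rightarrow> g m * g n)"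
      by (simp add: mn)
  qed auto
  moreover have inj: "inj e"
  proof (rule injI)
    fix x y assume "e x = e y"
    moreover obtain m n m' n' where xy: "x = (m, n)" "y = (m', n')" by (metis prod.exhaust)
    ultimately have z: "of_real (of_int (m - m')) * a + of_real (of_int (n - n')) * b = 0"
      by (simp add: e_def algebra_simps)
    show "x = y" using C(2)[of "of_int (m - m')" "of_int (n - n')"] C(3)[of "of_int (n - n')" "of_int (m - m')"]
      unfolding z xy by auto
  qed
  moreover have "e ` (UNIV - {(0,0)}) = L - {0}"
  proof -
    have "e ` (UNIV - {(0,0)}) = range e - {0}"
      by (subst image_set_diff[OF inj]) (simp add: e_def)
    also have "range e = L" unfolding ab(3) e_def by auto
    finally show ?thesis .
  qed
  ultimately show ?thesis
    using summable_on_reindex[of e "UNIV - {(0,0)}" "\<lambda>l. 1 / norm l ^ 3"]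
      inj_on_subset[OF inj subset_UNIV] by (simp add: o_def)
qed

subsection \<open>The Weierstrass function\<close>

lemma weierstrass_p_summand_bound:
  fixes z l :: complex
  assumes "norm z \<le> R" "2 * R < norm l"
  shows "norm (1 / (z - l) ^ 2 - 1 / l ^ 2) \<le> 10 * R / norm l ^ 3"
proof -
  have R: "R \<ge> 0" using assms(1) norm_ge_zero[of z] by linarith
  have l: "norm l > 0" using R assms by linarith
  have zl: "norm (z - l) \<ge> norm l / 2"
    using norm_triangle_ineq2[of l z] assms by (simp add: norm_minus_commute)
  hence zl0: "norm (z - l) > 0" using l by linarith
  have "1 / (z - l) ^ 2 - 1 / l ^ 2 = z * (2 * l - z) / ((z - l) ^ 2 * l ^ 2)"
  proof -
    have "1 / x ^ 2 - 1 / l ^ 2 = (l - x) * (l + x) / (x ^ 2 * l ^ 2)" if "x \<noteq> 0" for x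
      using that l by (simp add: divide_simps) (simp add: algebra_simps power2_eq_square)
    from this[of "z - l"] show ?thesis using zl0 by (simp add: algebra_simps)
  qed
  hence "norm (1 / (z - l) ^ 2 - 1 / l ^ 2)
      = (norm z * norm (2 * l - z)) / (norm (z - l) ^ 2 * norm l ^ 2)"
    by (simp add: norm_mult norm_divide norm_power)
  \<comment> \<open>The distance from \<open>z\<close> to \<open>l\<close> is at least half of
    \<open>norm l\<close>, which costs a factor 4; with the factor 5/2 of the numerator this gives
    the constant 10.\<close>
  also have "\<dots> \<le> (R * (5 / 2 * norm l)) / ((norm l / 2) ^ 2 * norm l ^ 2)"
  proof (rule frac_le)
    have "norm (2 * l - z) \<le> norm (2 * l) + norm z" by (rule norm_triangle_ineq4)
    also have "\<dots> \<le> 5 / 2 * norm l" using assms by (simp add: norm_mult)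
    finally show "norm z * norm (2 * l - z) \<le> R * (5 / 2 * norm l)"
      using assms R by (intro mult_mono) auto
    show "(norm l / 2) ^ 2 * norm l ^ 2 \<le> norm (z - l) ^ 2 * norm l ^ 2"
      using zl l by (intro mult_right_mono power_mono) auto
  qed (use R l in auto)
  also have "\<dots> = 10 * R / norm l ^ 3"
    using l by (simp add: field_simps power2_eq_square power3_eq_cube)
  finally show ?thesis .
qed

lemma inverse_square_has_derivative:
  fixes z l c :: complex
  assumes "z \<noteq> l"
  shows "((\<lambda>z. 1 / (z - l) ^ 2 - c) has_field_derivative - 2 / (z - l) ^ 3) (at z)"
proof -
  have "- (2 * x) / (x ^ 2 * x ^ 2) = - 2 / x ^ 3" if "x \<noteq> 0" for x :: complex
    using that by (simp add: power2_eq_square power3_eq_cube)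
  from this[of "z - l"] show ?thesis
    using assms by (auto intro!: derivative_eq_intros)
qed

lemma inverse_square_sum_has_derivative:
  fixes z :: complex
  assumes "\<And>l. l \<in> X \<Longrightarrow> z \<noteq> l"
  shows "((\<lambda>z. \<Sum>l\<in>X. 1 / (z - l) ^ 2 - 1 / l ^ 2) has_field_derivative
      (\<Sum>l\<in>X. - 2 / (z - l) ^ 3)) (at z)"
  by (rule DERIV_sum, rule inverse_square_has_derivative, rule assms)

text \<open>Lattice points of norm above \<open>2 * R\<close> stay away from the disc. The summand
  bound therefore gives uniform convergence of the tail there, and the tail may be differentiated
  term by term. Only finitely many summands that can have poles are kept apart.\<close>

lemma weierstrass_p_local:
  assumes L: "is_lattice L" and R: "R > 0"
  obtains h where "h holomorphic_on ball 0 R"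
    "\<And>z. z \<in> ball 0 R \<Longrightarrow> weierstrass_p L z =
        1 / z ^ 2 + (\<Sum>l\<in>{l\<in>L. norm l \<le> 2 * R} - {0}. 1 / (z - l) ^ 2 - 1 / l ^ 2) + h z"
    "\<And>z. z \<in> ball 0 R \<Longrightarrow>
        ((\<lambda>l. - 2 / (z - l) ^ 3) has_sum deriv h z) (L - {l\<in>L. norm l \<le> 2 * R})"
proof -
  define F where "F = {l\<in>L. norm l \<le> 2 * R}"
  define T where "T = (\<lambda>l z::complex. 1 / (z - l) ^ 2 - 1 / l ^ 2)"
  define h where "h = (\<lambda>z. \<Sum>\<^sub>\<infinity>l\<in>L - F. T l z)"
  have finF: "finite F" unfolding F_def by (rule lattice_finite_ball[OF L])
  have big: "2 * R < norm l" if "l \<in> L - F" for l using that by (auto simp: F_def)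
  have "0 \<in> F" using R lattice_0[OF L] by (simp add: F_def)
  have "(\<lambda>l. 1 / norm l ^ 3) summable_on (L - F)"
    by (rule summable_on_subset_banach[OF lattice_summable_cube[OF L]]) (use \<open>0 \<in> F\<close> in auto)
  hence "(\<lambda>l. 10 * R * (1 / norm l ^ 3)) summable_on (L - F)" by (rule summable_on_cmult_right)
  hence summ: "(\<lambda>l. 10 * R / norm l ^ 3) summable_on (L - F)" by simp
  have bound: "norm (T l z) \<le> 10 * R / norm l ^ 3" if "l \<in> L - F" "z \<in> cball 0 R" for l z
    unfolding T_def by (rule weierstrass_p_summand_bound) (use that big in auto)
  have ul: "uniform_limit (cball 0 R) (\<lambda>X z. \<Sum>l\<in>X. T l z) h (finite_subsets_at_top (L - F))"
    unfolding h_def by (rule Weierstrass_m_test_general[OF bound summ])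
  have ne: "l \<noteq> z" if "l \<in> L - F" "z \<in> cball 0 R" for l z
    using big[OF that(1)] that(2) R by auto
  have hol: "\<forall>\<^sub>F X in finite_subsets_at_top (L - F). (\<lambda>z. \<Sum>l\<in>X. T l z) holomorphic_on cball 0 R"
    unfolding T_def
    by (rule eventually_finite_subsets_at_top_weakI) (use ne in \<open>force intro!: holomorphic_intros\<close>)
  have hol': "\<forall>\<^sub>F X in finite_subsets_at_top (L - F). continuous_on (cball 0 R) (\<lambda>z. \<Sum>l\<in>X. T l z)
      \<and> (\<lambda>z. \<Sum>l\<in>X. T l z) holomorphic_on ball 0 R"
    using hol by eventually_elim
      (auto intro: holomorphic_on_imp_continuous_on elim: holomorphic_on_subset)
  have h1: "h holomorphic_on ball 0 R"
    using holomorphic_uniform_limit[OF hol' ul] by simp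
  have h2: "weierstrass_p L z = 1 / z ^ 2 + (\<Sum>l\<in>F - {0}. 1 / (z - l) ^ 2 - 1 / l ^ 2) + h z"
    if "z \<in> ball 0 R" for z
  proof -
    have s: "(\<lambda>l. T l z) summable_on (L - F)"
    proof (rule Infinite_Sum.abs_summable_summable)
      show "(\<lambda>l. norm (T l z)) summable_on (L - F)"
        by (rule summable_on_comparison_test[OF summ]) (use bound that in auto)
    qed
    have "L - {0} = (F - {0}) \<union> (L - F)" using \<open>0 \<in> F\<close> by (auto simp: F_def)
    hence "(\<Sum>\<^sub>\<infinity>l\<in>L - {0}. T l z) = (\<Sum>\<^sub>\<infinity>l\<in>F - {0}. T l z) + (\<Sum>\<^sub>\<infinity>l\<in>L - F. T l z)"
      using finF s by (subst infsum_Un_disjoint[symmetric]) auto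
    thus ?thesis using finF by (simp add: weierstrass_p_def T_def h_def)
  qed
  have h3: "((\<lambda>l. - 2 / (z - l) ^ 3) has_sum deriv h z) (L - F)" if z: "z \<in> ball 0 R" for z
  proof -
    have lim: "((\<lambda>X. (deriv ^^ 1) (\<lambda>z. \<Sum>l\<in>X. T l z) z) \<longlongrightarrow> (deriv ^^ 1) h z) (finite_subsets_at_top (L - F))"
    proof (rule higher_deriv_complex_uniform_limit[where A = "ball 0 R"])
      show "uniform_limit (ball 0 R) (\<lambda>X z. \<Sum>l\<in>X. T l z) h (finite_subsets_at_top (L - F))"
        by (rule uniform_limit_on_subset[OF ul]) auto
      show "\<forall>\<^sub>F X in finite_subsets_at_top (L - F). (\<lambda>z. \<Sum>l\<in>X. T l z) holomorphic_on ball 0 R"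
        using hol' by eventually_elim auto
    qed (use z in auto)
    have "(deriv ^^ 1) (\<lambda>z. \<Sum>l\<in>X. T l z) z = (\<Sum>l\<in>X. - 2 / (z - l) ^ 3)"
      if "finite X" "X \<subseteq> L - F" for X
    proof -
      have zl: "z \<noteq> l" if "l \<in> X" for l using ne[of l z] that \<open>X \<subseteq> L - F\<close> z by auto
      show ?thesis unfolding T_def
        using DERIV_imp_deriv[OF inverse_square_sum_has_derivative[of X z, OF zl]] by simp
    qed
    hence "\<forall>\<^sub>F X in finite_subsets_at_top (L - F).
        (\<Sum>l\<in>X. - 2 / (z - l) ^ 3) = (deriv ^^ 1) (\<lambda>z. \<Sum>l\<in>X. T l z) z"
      by (intro eventually_finite_subsets_at_top_weakI) metis
    from tendsto_cong[OF this] lim show ?thesis unfolding has_sum_def by simp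
  qed
  show ?thesis by (rule that[OF h1 h2[unfolded F_def] h3[unfolded F_def]])
qed

lemma weierstrass_p_analytic:
  assumes L: "is_lattice L" and z: "z \<notin> L"
  shows "weierstrass_p L analytic_on {z}"
    and "((\<lambda>l. - 2 / (z - l) ^ 3) has_sum deriv (weierstrass_p L) z) L"
proof -
  define R where "R = norm z + 1"
  have R: "R > 0" "z \<in> ball 0 R" by (auto simp: R_def add_nonneg_pos)
  define F where "F = {l\<in>L. norm l \<le> 2 * R}"
  have finF: "finite F" unfolding F_def by (rule lattice_finite_ball[OF L])
  have F0: "0 \<in> F" using R lattice_0[OF L] by (simp add: F_def)
  obtain h where h: "h holomorphic_on ball 0 R"
    "\<And>z. z \<in> ball 0 R \<Longrightarrow> weierstrass_p L z =
        1 / z ^ 2 + (\<Sum>l\<in>F - {0}. 1 / (z - l) ^ 2 - 1 / l ^ 2) + h z"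
    "\<And>z. z \<in> ball 0 R \<Longrightarrow> ((\<lambda>l. - 2 / (z - l) ^ 3) has_sum deriv h z) (L - F)"
    using weierstrass_p_local[OF L R(1)] unfolding F_def by blast
  \<comment> \<open>Summation over all of \<open>F\<close> absorbs the separate term
    \<open>1 / z ^ 2\<close>: for \<open>l = 0\<close> the correction \<open>1 / l ^ 2\<close> is 0
    by the convention for division by zero.\<close>
  define g where "g = (\<lambda>z. (\<Sum>l\<in>F. 1 / (z - l) ^ 2 - 1 / l ^ 2) + h z)"
  have wp: "weierstrass_p L z = g z" if "z \<in> ball 0 R" for z
    using h(2)[OF that] finF F0 unfolding g_def by (subst sum.remove[of F 0]) auto
  have ev: "\<forall>\<^sub>F x in nhds z. weierstrass_p L x = g x"
    using eventually_nhds_in_open[OF open_ball R(2)] by eventually_elim (rule wp)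
  have zF: "z \<noteq> l" if "l \<in> F" for l using z that by (auto simp: F_def)
  have hz: "h analytic_on {z}" by (rule holomorphic_on_imp_analytic_at[OF h(1) _ R(2)]) auto
  have "g analytic_on {z}" unfolding g_def using zF hz by (auto intro!: analytic_intros)
  thus "weierstrass_p L analytic_on {z}" using analytic_at_cong[OF ev refl] by simp
  have "(h has_field_derivative deriv h z) (at z)"
    using analytic_on_imp_differentiable_at[OF hz] DERIV_deriv_iff_field_differentiable by blast
  hence "(g has_field_derivative (\<Sum>l\<in>F. - 2 / (z - l) ^ 3) + deriv h z) (at z)"
    unfolding g_def by (intro DERIV_add inverse_square_sum_has_derivative zF)
  hence d: "deriv (weierstrass_p L) z = (\<Sum>l\<in>F. - 2 / (z - l) ^ 3) + deriv h z"
    using deriv_cong_ev[OF ev refl] DERIV_imp_deriv by metis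
  have "((\<lambda>l. - 2 / (z - l) ^ 3) has_sum deriv (weierstrass_p L) z) (F \<union> (L - F))"
    unfolding d by (rule has_sum_Un_disjoint[OF has_sum_finite[OF finF] h(3)[OF R(2)]]) auto
  moreover have "F \<union> (L - F) = L" by (auto simp: F_def)
  ultimately show "((\<lambda>l. - 2 / (z - l) ^ 3) has_sum deriv (weierstrass_p L) z) L" by simp
qed

lemma weierstrass_p_holomorphic: "is_lattice L \<Longrightarrow> weierstrass_p L holomorphic_on - L"
  using weierstrass_p_analytic(1)[of L]
  by (intro analytic_imp_holomorphic) (subst analytic_on_analytic_at, blast)

lemma weierstrass_p_removable:
  assumes L: "is_lattice L"
  shows "removable_at (\<lambda>z. weierstrass_p L z - 1 / z ^ 2) 0"
proof (rule weierstrass_p_local[OF L zero_less_one])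
  fix h
  define g where "g = (\<lambda>z. \<Sum>l\<in>{l\<in>L. norm l \<le> 2 * 1} - {0}. 1 / (z - l) ^ 2 - 1 / l ^ 2)"
  assume h: "h holomorphic_on ball 0 1"
    "\<And>z. z \<in> ball 0 1 \<Longrightarrow> weierstrass_p L z =
      1 / z ^ 2 + (\<Sum>l\<in>{l\<in>L. norm l \<le> 2 * 1} - {0}. 1 / (z - l) ^ 2 - 1 / l ^ 2) + h z"
  have "h analytic_on {0}" by (rule holomorphic_on_imp_analytic_at[OF h(1)]) auto
  moreover have "g analytic_on {0}"
    unfolding g_def by (intro analytic_intros) auto
  ultimately have "(\<lambda>z. g z + h z) analytic_on {0}" by (rule analytic_on_add[rotated])
  moreover have "\<forall>\<^sub>F z in at 0. weierstrass_p L z - 1 / z ^ 2 = g z + h z"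
  proof -
    have "\<forall>\<^sub>F z in at (0::complex). z \<in> ball 0 1 - {0}" by (rule eventually_at_in_open) auto
    thus ?thesis by eventually_elim (simp add: h(2) g_def)
  qed
  ultimately show ?thesis by (rule removable_atI)
qed

text \<open>It serves twice: for the rotations in \<open>W\<close>, and for \<open>u = - 1\<close>,
  which is a root of unity of order dividing \<open>m\<close> only when \<open>m\<close> is
  even.\<close>

lemma weierstrass_p_homothety:
  assumes "u \<noteq> 0" "(*) u ` L = L"
  shows "weierstrass_p L (u * z) = weierstrass_p L z / u ^ 2"
proof -
  have "bij_betw ((*) u) (L - {0}) (L - {0})"
  proof -
    have "inj ((*) u)" using assms(1) by (auto simp: inj_on_def)
    hence "(*) u ` (L - {0}) = (*) u ` L - {u * 0}" by (subst image_set_diff) auto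
    thus ?thesis using assms unfolding bij_betw_def by (auto simp: inj_on_def)
  qed
  hence "(\<Sum>\<^sub>\<infinity>l\<in>L - {0}. 1 / (u * z - l) ^ 2 - 1 / l ^ 2)
      = (\<Sum>\<^sub>\<infinity>l\<in>L - {0}. 1 / (u * z - u * l) ^ 2 - 1 / (u * l) ^ 2)"
    by (rule infsum_reindex_bij_betw[symmetric])
  also have "\<dots> = (\<Sum>\<^sub>\<infinity>l\<in>L - {0}. 1 / u ^ 2 * (1 / (z - l) ^ 2 - 1 / l ^ 2))"
    proof (rule infsum_cong)
    fix l
    have "u * z - u * l = u * (z - l)" by (simp add: algebra_simps)
    thus "1 / (u * z - u * l) ^ 2 - 1 / (u * l) ^ 2 = 1 / u ^ 2 * (1 / (z - l) ^ 2 - 1 / l ^ 2)"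
      by (simp add: power_mult_distrib diff_divide_distrib mult.commute)
  qed
  also have "\<dots> = 1 / u ^ 2 * (\<Sum>\<^sub>\<infinity>l\<in>L - {0}. 1 / (z - l) ^ 2 - 1 / l ^ 2)"
    by (rule infsum_cmult_right')
  finally show ?thesis using assms(1)
    by (simp add: weierstrass_p_def power_mult_distrib add_divide_distrib)
qed

lemma weierstrass_p_minus:
  assumes "is_lattice L"
  shows "weierstrass_p L (- z) = weierstrass_p L z"
proof -
  have "(*) (- 1) ` L = L"
    using lattice_minus_iff[OF assms] by (auto simp: image_iff) (metis minus_minus)
  thus ?thesis using weierstrass_p_homothety[of "- 1" L z] by simp
qed

text \<open>The derivative is a sum over the whole lattice, so reindexing makes it periodic, and
  \<open>D\<close> is constant on the connected complement of \<open>L\<close>. Evenness gives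
  \<open>D (- z - l) = - D z\<close>, hence the constant is 0. Pairing \<open>z\<close> with
  \<open>- z - l\<close> works even if \<open>l / 2\<close> is a lattice point, where evaluation at
  \<open>- l / 2\<close> would hit a pole.\<close>

lemma weierstrass_p_periodic:
  assumes L: "is_lattice L" and l: "l \<in> L" and z: "z \<notin> L"
  shows "weierstrass_p L (z + l) = weierstrass_p L z"
proof -
  have notin: "w + l \<notin> L" if "w \<notin> L" for w
    using lattice_add_iff[OF L l] that by simp
  have dper: "deriv (weierstrass_p L) (w + l) = deriv (weierstrass_p L) w" if w: "w \<notin> L" for w
  proof -
    have "bij_betw (\<lambda>x. x + l) L L"
      by (rule bij_betwI[where g = "\<lambda>x. x - l"]) (auto intro: lattice_add[OF L _ l] lattice_diff[OF L _ l])
    hence "((\<lambda>x. - 2 / (w + l - (x + l)) ^ 3) has_sum deriv (weierstrass_p L) (w + l)) L"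
      using weierstrass_p_analytic(2)[OF L notin[OF w]]
      by (simp only: has_sum_reindex_bij_betw[where f = "\<lambda>x. - 2 / (w + l - x) ^ 3"])
    hence "((\<lambda>x. - 2 / (w - x) ^ 3) has_sum deriv (weierstrass_p L) (w + l)) L" by simp
    thus ?thesis using weierstrass_p_analytic(2)[OF L w] has_sum_unique by blast
  qed
  define D where "D = (\<lambda>w. weierstrass_p L (w + l) - weierstrass_p L w)"
  have "(D has_field_derivative 0) (at w)" if "w \<in> - L" for w
  proof -
    have d: "(weierstrass_p L has_field_derivative deriv (weierstrass_p L) x) (at x)" if "x \<notin> L" for x
      using weierstrass_p_analytic(1)[OF L that] analytic_on_imp_differentiable_at DERIV_deriv_iff_field_differentiable by blast
    have "((\<lambda>w. weierstrass_p L (w + l)) has_field_derivative deriv (weierstrass_p L) (w + l)) (at w)"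
      using d[OF notin] that by (subst DERIV_shift[symmetric]) auto
    thus ?thesis unfolding D_def using d[of w] dper[of w] that
      by (auto intro!: derivative_eq_intros)
  qed
  then obtain c where c: "\<And>w. w \<notin> L \<Longrightarrow> D w = c"
    using DERIV_zero_connected_constant[OF lattice_connected_compl[OF L] lattice_open_compl[OF L], of "{}" D]
    by (metis ComplI DiffD1 finite.emptyI DERIV_isCont continuous_at_imp_continuous_on)
  have "- z - l \<notin> L" using notin[OF z] lattice_minus_iff[OF L, of "z + l"] by simp
  hence "D (- z - l) = D z" using c z by simp
  moreover have "D (- z - l) = weierstrass_p L (- z) - weierstrass_p L (- (z + l))" by (simp add: D_def)
  ultimately have "weierstrass_p L z - weierstrass_p L (z + l) = weierstrass_p L (z + l) - weierstrass_p L z"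
    unfolding D_def weierstrass_p_minus[OF L] by metis
  thus ?thesis by (simp add: algebra_simps)
qed

subsection \<open>Elliptic functions with one pole and invariant under rotations\<close>

lemma higher_deriv_inverse:
  fixes a z :: complex
  assumes "z \<noteq> a"
  shows "(deriv ^^ n) (\<lambda>v. 1 / (v - a)) z = (- 1) ^ n * fact n / (z - a) ^ Suc n"
  using assms
proof (induction n arbitrary: z)
  case (Suc n)
  have "\<forall>\<^sub>F w in nhds z. w \<in> - {a}"
    by (rule eventually_nhds_in_open) (use Suc.prems in auto)
  hence "\<forall>\<^sub>F w in nhds z. (deriv ^^ n) (\<lambda>v. 1 / (v - a)) w
      = ((- 1) ^ n * fact n) * inverse ((w - a) ^ Suc n)"
    by eventually_elim (use Suc.IH in \<open>auto simp: divide_inverse\<close>)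
  hence "(deriv ^^ Suc n) (\<lambda>v. 1 / (v - a)) z
      = deriv (\<lambda>w. ((- 1) ^ n * fact n) * inverse ((w - a) ^ Suc n)) z"
    using deriv_cong_ev[OF _ refl] by (simp only: funpow.simps o_apply)
  also have "\<dots> = (- 1) ^ Suc n * fact (Suc n) / (z - a) ^ Suc (Suc n)"
  proof (rule DERIV_imp_deriv)
    have D: "((\<lambda>w. (w - a) ^ Suc n) has_field_derivative of_nat (Suc n) * (z - a) ^ n) (at z)"
      by (rule derivative_eq_intros refl)+ simp
    have nz: "(z - a) ^ Suc n \<noteq> 0" using Suc.prems by simp
    have "((\<lambda>w. ((- 1) ^ n * fact n) * inverse ((w - a) ^ Suc n)) has_field_derivative
        ((- 1) ^ n * fact n) * - (inverse ((z - a) ^ Suc n) * (of_nat (Suc n) * (z - a) ^ n) * inverse ((z - a) ^ Suc n))) (at z)"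
      by (rule DERIV_cmult[OF DERIV_inverse'[OF D nz]])
    moreover have ident: "A * - (inverse (x ^ Suc n) * (of_nat (Suc n) * x ^ n) * inverse (x ^ Suc n))
        = - A * of_nat (Suc n) / x ^ Suc (Suc n)" if "x \<noteq> 0" for A x :: complex
      using that by (simp add: field_simps)
    moreover have "- ((- 1) ^ n * fact n) * of_nat (Suc n) = (- 1) ^ Suc n * (fact (Suc n) :: complex)"
      by (simp add: algebra_simps)
    ultimately show "((\<lambda>w. ((- 1) ^ n * fact n) * inverse ((w - a) ^ Suc n)) has_field_derivative
        (- 1) ^ Suc n * fact (Suc n) / (z - a) ^ Suc (Suc n)) (at z)"
      using ident[of "z - a" "(- 1) ^ n * fact n"] Suc.prems by (simp only: right_minus_eq not_False_eq_True simp_thms)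
  qed
  finally show ?case .
qed auto

lemma open_not_subset_countable:
  fixes U :: "complex set"
  assumes "open U" "U \<noteq> {}" "countable C"
  shows "\<not> U \<subseteq> C"
proof
  assume "U \<subseteq> C"
  moreover obtain x e where "e > 0" "ball x e \<subseteq> U"
    using assms(1,2) by (metis ex_in_conv open_contains_ball)
  ultimately have "countable (ball x e)" using assms(3) by (meson countable_subset)
  thus False using uncountable_ball \<open>e > 0\<close> by blast
qed

text \<open>
  The constant \<open>c\<close> is the leading coefficient of the derivative of order \<open>m - 2\<close> of \<open>1 / z\<^sup>2\<close>.
\<close>

locale rotation_elliptic =
  fixes W L :: "complex set" and m :: nat and S :: "complex \<Rightarrow> complex" and c :: complex
  assumes L: "is_lattice L" and m2: "m \<ge> 2" and W: "W = {\<zeta>. \<zeta> ^ m = 1}"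
    and c_def: "c = (- 1) ^ m * fact (m - 1)"
    and inv: "invariant_under W L"
    and hol: "S holomorphic_on - L"
    and per: "\<And>l z. l \<in> L \<Longrightarrow> z \<notin> L \<Longrightarrow> S (z + l) = S z"
    and rot: "\<And>\<zeta> z. \<zeta> \<in> W \<Longrightarrow> z \<notin> L \<Longrightarrow> S (\<zeta> * z) = S z"
    and parity: "\<And>z. z \<notin> L \<Longrightarrow> S (- z) = (- 1) ^ m * S z"
    and pole: "removable_at (\<lambda>z. S z - c / z ^ m) 0"

begin

lemma c0: "c \<noteq> 0" by (simp add: c_def)

lemma W_nonzero: "\<zeta> \<in> W \<Longrightarrow> \<zeta> \<noteq> 0"
  using m2 by (auto simp: W power_0_left)

lemma W_norm: "\<zeta> \<in> W \<Longrightarrow> norm \<zeta> = 1"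
  using m2 power_eq_1_iff[of \<zeta> m] by (auto simp: W)

lemma W_one: "1 \<in> W" by (simp add: W)

lemma W_mult: "\<zeta> \<in> W \<Longrightarrow> \<xi> \<in> W \<Longrightarrow> \<zeta> * \<xi> \<in> W"
  by (simp add: W power_mult_distrib)

lemma W_inverse: "\<zeta> \<in> W \<Longrightarrow> inverse \<zeta> \<in> W"
  by (simp add: W power_inverse)

lemma W_finite: "finite W" and W_card: "card W = m"
  using m2 finite_roots_unity[of m] card_roots_unity_eq[of m] by (auto simp: W)

lemma W_mult_L: "\<zeta> \<in> W \<Longrightarrow> x \<in> L \<Longrightarrow> \<zeta> * x \<in> L"
  using inv by (auto simp: invariant_under_def)

lemma W_mult_L_iff:
  assumes "\<zeta> \<in> W"
  shows "\<zeta> * x \<in> L \<longleftrightarrow> x \<in> L"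
proof
  assume "\<zeta> * x \<in> L"
  hence "inverse \<zeta> * (\<zeta> * x) \<in> L" by (rule W_mult_L[OF W_inverse[OF assms]])
  moreover have "inverse \<zeta> * (\<zeta> * x) = x" using W_nonzero[OF assms] by simp
  ultimately show "x \<in> L" by metis
qed (rule W_mult_L[OF assms])

lemma zero_in_L: "0 \<in> L" by (rule lattice_0[OF L])

lemma analytic: "z \<notin> L \<Longrightarrow> S analytic_on {z}"
  by (rule holomorphic_on_imp_analytic_at[OF hol lattice_open_compl[OF L]]) simp

lemma S_cong: "x - y \<in> L \<Longrightarrow> y \<notin> L \<Longrightarrow> S x = S y"
  using per[of "x - y" y] by simp

lemma pole_at_lattice:
  assumes l: "l \<in> L"
  shows "removable_at (\<lambda>z. S z - c / (z - l) ^ m) l"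
proof -
  have "removable_at (\<lambda>z. S (1 * z + - l) - c / (1 * z + - l) ^ m) l"
    by (rule removable_at_affine) (use pole in auto)
  moreover have "\<forall>\<^sub>F z in at l. S z - c / (z - l) ^ m = S (1 * z + - l) - c / (1 * z + - l) ^ m"
    using lattice_eventually[OF L, of l]
  proof eventually_elim
    case (elim z)
    have "S (z - l) = S z" using l elim lattice_minus[OF L l] by (intro S_cong) auto
    thus ?case by simp
  qed
  ultimately show ?thesis by (rule removable_at_cong)
qed

lemma tends_to_infinity:
  assumes l: "l \<in> L"
  shows "filterlim S at_infinity (at l)"
proof -
  obtain d where d: "(\<lambda>z. S z - c / (z - l) ^ m) \<midarrow>l\<rightarrow> d"
    using removable_at_tendsto[OF pole_at_lattice[OF l]] by blast
  have "filterlim (\<lambda>z. (z - l) ^ m) (at 0) (at l)"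
    using m2 by (intro filterlim_atI)
      (auto intro!: tendsto_eq_intros simp: eventually_at_filter)
  hence "filterlim (\<lambda>z. c / (z - l) ^ m) at_infinity (at l)"
    using c0 by (intro filterlim_divide_at_infinity[of _ c]) auto
  hence "filterlim (\<lambda>z. (S z - c / (z - l) ^ m) + c / (z - l) ^ m) at_infinity (at l)"
    by (rule tendsto_add_filterlim_at_infinity[OF d])
  thus ?thesis by simp
qed

lemma not_constant: "\<not> S constant_on - L"
proof
  assume "S constant_on - L"
  then obtain k where k: "\<And>z. z \<notin> L \<Longrightarrow> S z = k" unfolding constant_on_def by auto
  have "\<forall>\<^sub>F z in at 0. S z = k" using lattice_eventually[OF L] by eventually_elim (rule k)
  hence "S \<midarrow>0\<rightarrow> k" by (rule tendsto_eventually)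
  thus False using not_tendsto_and_filterlim_at_infinity[OF at_neq_bot _ tends_to_infinity[OF zero_in_L]]
    by metis
qed

subsection \<open>Fibres\<close>

text \<open>
  The coordinate \<open>\<phi>\<close> in the proof satisfies \<open>\<phi> z ^ m = c / S z\<close>. It commutes with the rotations because
  its second factor is a function of \<open>z ^ m * r z\<close>, where \<open>r\<close> is the regular part of \<open>S\<close>.
\<close>

lemma fibre_near_zero:
  obtains e where "e > 0"
    "\<And>z u. z \<in> ball 0 e - {0} \<Longrightarrow> u \<in> ball 0 e - {0} \<Longrightarrow> S z = S u \<Longrightarrow> \<exists>\<zeta>\<in>W. u = \<zeta> * z"
proof -
  obtain r where r: "r analytic_on {0}" "\<forall>\<^sub>F z in at 0. S z - c / z ^ m = r z"
    using pole unfolding removable_at_def by blast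
  obtain d1 where d1: "d1 > 0" "r holomorphic_on ball 0 d1"
    using r(1) analytic_at_ball by blast
  obtain d2 where d2: "d2 > 0" "\<And>z. z \<noteq> 0 \<Longrightarrow> dist z 0 < d2 \<Longrightarrow> S z - c / z ^ m = r z \<and> z \<notin> L"
    using eventually_conj[OF r(2) lattice_eventually[OF L]] unfolding eventually_at by blast
  \<comment> \<open>Near 0 this means \<open>S z = c * g z / z ^ m\<close> with
    \<open>g 0 = 1\<close>. Confining \<open>g\<close> to the unit disc about 1 keeps it off the
    branch cut of \<open>Ln\<close>, so that \<open>g\<close> has a holomorphic \<open>m\<close>-th
    root.\<close>
  define g where "g = (\<lambda>z. 1 + z ^ m * r z / c)"
  have rc: "isCont r 0" using analytic_at_imp_isCont[OF r(1)] .
  have "isCont g 0" unfolding g_def using c0 by (intro continuous_intros rc) auto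
  moreover have g0: "g 0 = 1" using m2 by (simp add: g_def)
  ultimately obtain d3 where d3: "d3 > 0" "\<And>z. dist z 0 < d3 \<Longrightarrow> g z \<in> ball 1 1"
    unfolding continuous_at_eps_delta by (metis dist_commute mem_ball zero_less_one)
  define d where "d = min d1 (min d2 d3)"
  have d: "d > 0" using d1 d2 d3 by (simp add: d_def)
  have g_nonpos: "g z \<notin> \<real>\<^sub>\<le>\<^sub>0" if "z \<in> ball 0 d" for z
  proof
    assume "g z \<in> \<real>\<^sub>\<le>\<^sub>0"
    hence "Re (g z) \<le> 0" using complex_nonpos_Reals_iff by blast
    moreover have "norm (1 - g z) < 1" using d3(2)[of z] that by (simp add: d_def dist_norm)
    ultimately show False using complex_Re_le_cmod[of "1 - g z"] by simp
  qed
  define \<phi> where "\<phi> = (\<lambda>z. z * exp (- Ln (g z) / of_nat m))"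
  have ghol: "g holomorphic_on ball 0 d"
    unfolding g_def using c0
    by (intro holomorphic_intros holomorphic_on_subset[OF d1(2)]) (auto simp: d_def)
  hence "(\<lambda>z. Ln (g z)) holomorphic_on ball 0 d"
    using g_nonpos by (intro holomorphic_on_Ln') auto
  hence ehol: "(\<lambda>z. exp (- Ln (g z) / of_nat m)) holomorphic_on ball 0 d"
    using m2 by (intro holomorphic_on_exp' holomorphic_on_divide holomorphic_on_minus) auto
  have \<phi>_hol: "\<phi> holomorphic_on ball 0 d"
    unfolding \<phi>_def by (intro holomorphic_on_mult ehol holomorphic_on_ident)
  have \<phi>_deriv: "deriv \<phi> 0 \<noteq> 0"
  proof -
    define E where "E = (\<lambda>z. exp (- Ln (g z) / of_nat m))"
    have "(E has_field_derivative deriv E 0) (at 0)"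
      unfolding E_def by (rule holomorphic_derivI[OF ehol]) (use d in auto)
    hence "((\<lambda>z. z * E z) has_field_derivative 1 * E 0 + deriv E 0 * 0) (at 0)"
      by (rule DERIV_mult[OF DERIV_ident])
    hence "deriv \<phi> 0 = 1 * E 0 + deriv E 0 * 0"
      unfolding \<phi>_def E_def by (rule DERIV_imp_deriv)
    thus ?thesis by (simp add: E_def g0)
  qed
  have zero_in: "0 \<in> ball (0::complex) d" using d by simp
  have "\<exists>e>0. ball (0::complex) e \<subseteq> ball 0 d \<and> inj_on \<phi> (ball 0 e)"
    by (rule has_complex_derivative_locally_injective[OF \<phi>_hol zero_in open_ball \<phi>_deriv]) blast
  then obtain e where e: "e > 0" "ball (0::complex) e \<subseteq> ball 0 d" "inj_on \<phi> (ball 0 e)"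
    by blast
  have \<phi>_power: "\<phi> z ^ m = c / S z \<and> S z \<noteq> 0" if "z \<in> ball 0 e - {0}" for z
  proof -
    have z: "z \<in> ball 0 d" "z \<noteq> 0" using that e by auto
    have "g z \<noteq> 0" using g_nonpos[OF z(1)] by auto
    have "S z - c / z ^ m = r z" using d2(2)[of z] z by (auto simp: d_def)
    hence "S z = c / z ^ m + r z" by (simp only: diff_eq_eq add.commute)
    also have "\<dots> = c * g z / z ^ m"
      using z(2) c0 by (simp add: g_def distrib_left add_divide_distrib)
    finally have Sz: "S z = c * g z / z ^ m" .
    have "exp (- Ln (g z) / of_nat m) ^ m = exp (of_nat m * (- Ln (g z) / of_nat m))"
      by (rule exp_of_nat_mult[symmetric])
    also have "of_nat m * (- Ln (g z) / of_nat m) = - Ln (g z)" using m2 by simp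
    also have "exp (- Ln (g z)) = 1 / g z"
      using exp_Ln[OF \<open>g z \<noteq> 0\<close>] by (simp add: exp_minus inverse_eq_divide)
    finally have "\<phi> z ^ m = z ^ m * (1 / g z)" by (simp only: \<phi>_def power_mult_distrib)
    thus ?thesis using z(2) c0 \<open>g z \<noteq> 0\<close> by (simp add: Sz)
  qed
  have \<phi>_rot: "\<phi> (\<zeta> * z) = \<zeta> * \<phi> z" if "z \<in> ball 0 e - {0}" "\<zeta> \<in> W" for z \<zeta>
  proof -
    have n1: "norm \<zeta> = 1" using that(2) by (rule W_norm)
    have z: "z \<in> ball 0 d" "z \<noteq> 0" using that e by auto
    have *: "S w - c / w ^ m = r w" if "w \<in> ball 0 d" "w \<noteq> 0" for w
      using d2(2)[of w] that by (auto simp: d_def)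
    have "r (\<zeta> * z) = S (\<zeta> * z) - c / (\<zeta> * z) ^ m"
      using *[of "\<zeta> * z"] z n1 W_nonzero[OF that(2)] by (simp add: norm_mult)
    also have "\<dots> = r z"
      using *[of z] z that(2) d2(2)[of z] rot[OF that(2), of z] by (auto simp: d_def W power_mult_distrib)
    finally have "g (\<zeta> * z) = g z" using that(2) by (simp add: g_def W power_mult_distrib)
    thus ?thesis by (simp add: \<phi>_def)
  qed
  show ?thesis
  proof (rule that[OF e(1)])
    fix z u assume zu: "z \<in> ball 0 e - {0}" "u \<in> ball 0 e - {0}" "S z = S u"
    have "\<phi> z ^ m = \<phi> u ^ m" "\<phi> z ^ m \<noteq> 0"
      using \<phi>_power[OF zu(1)] \<phi>_power[OF zu(2)] zu(3) c0 by auto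
    \<comment> \<open>Two \<open>m\<close>-th roots of the same nonzero number differ by an element
      of \<open>W\<close>. Since \<open>\<phi>\<close> is injective and commutes with rotations,
      that element also takes \<open>z\<close> to \<open>u\<close>.\<close>
    hence \<zeta>: "\<phi> u / \<phi> z \<in> W" "\<phi> z \<noteq> 0" using m2 by (auto simp: W power_divide power_0_left)
    define \<zeta> where "\<zeta> = \<phi> u / \<phi> z"
    have "norm \<zeta> = 1" using \<zeta>(1) unfolding \<zeta>_def by (rule W_norm)
    hence "\<zeta> * z \<in> ball 0 e" using zu(1) by (simp add: norm_mult)
    moreover have "\<phi> (\<zeta> * z) = \<phi> u"
      using \<phi>_rot[OF zu(1), of \<zeta>] \<zeta> by (simp add: \<zeta>_def)
    ultimately have "\<zeta> * z = u" using e(3) zu(2) by (auto dest: inj_onD)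
    thus "\<exists>\<zeta>\<in>W. u = \<zeta> * z" using \<zeta>(1) unfolding \<zeta>_def by (metis (no_types))
  qed
qed

text \<open>Away from small discs about the lattice points \<open>S\<close> is bounded, by
  periodicity and compactness. For \<open>z\<close> close to 0 the value \<open>S z\<close> exceeds
  this bound, so every other preimage lies close to the lattice and a translation reduces the claim
  to \<open>fibre_near_zero\<close>.\<close>

lemma fibre_of_small:
  obtains e where "e > 0"
    "\<And>z u. z \<in> ball 0 e - {0} \<Longrightarrow> u \<notin> L \<Longrightarrow> S z = S u \<Longrightarrow> \<exists>\<zeta>\<in>W. u - \<zeta> * z \<in> L"
proof -
  obtain e0 where e0: "e0 > 0" "\<And>z u. z \<in> ball 0 e0 - {0} \<Longrightarrow> u \<in> ball 0 e0 - {0} \<Longrightarrow>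
      S z = S u \<Longrightarrow> \<exists>\<zeta>\<in>W. u = \<zeta> * z"
    using fibre_near_zero by blast
  obtain K where K: "compact K" "\<And>z. \<exists>l\<in>L. z + l \<in> K" 
    using lattice_fundamental[OF L] by blast
  define K' where "K' = K - (\<Union>l\<in>L. ball l e0)"
  have "compact K'" unfolding K'_def by (rule compact_diff[OF K(1)]) auto
  moreover have "K' \<subseteq> - L" using e0(1) by (auto simp: K'_def)
  ultimately have "bounded (S ` K')"
    by (meson compact_continuous_image compact_imp_bounded hol holomorphic_on_imp_continuous_on holomorphic_on_subset)
  then obtain B where B: "\<And>z. z \<in> K' \<Longrightarrow> norm (S z) \<le> B" unfolding bounded_iff by blast
  have "\<forall>\<^sub>F z in at 0. norm (S z) \<ge> \<bar>B\<bar> + 1"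
    using tends_to_infinity[OF zero_in_L] unfolding filterlim_at_infinity[OF order.refl]
    by (metis abs_ge_zero add_nonneg_pos zero_less_one)
  then obtain e1 where e1: "e1 > 0" "\<And>z. z \<noteq> 0 \<Longrightarrow> dist z 0 < e1 \<Longrightarrow> norm (S z) \<ge> \<bar>B\<bar> + 1"
    unfolding eventually_at by blast
  show ?thesis
  proof (rule that[of "min e0 e1"])
    fix z u assume zu: "z \<in> ball 0 (min e0 e1) - {0}" "u \<notin> L" "S z = S u"
    obtain l where l: "l \<in> L" "u + l \<in> K" using K by blast
    have ul: "S (u + l) = S u" using per[OF l(1) zu(2)] .
    have "norm (S u) \<ge> \<bar>B\<bar> + 1" using e1(2)[of z] zu by simp
    hence "u + l \<notin> K'" using B[of "u + l"] ul by fastforce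
    then obtain l' where l': "l' \<in> L" "u + l - l' \<in> ball 0 e0"
      using l(2) by (auto simp: K'_def dist_norm norm_minus_commute)
    have ll: "l - l' \<in> L" using l l' lattice_diff[OF L] by blast
    have "u + l - l' \<notin> L" using lattice_add_iff[OF L ll, of u] zu(2) by (simp add: algebra_simps)
    moreover have "S (u + l - l') = S u"
      using per[OF ll zu(2)] by (simp add: algebra_simps)
    ultimately obtain \<zeta> where \<zeta>: "\<zeta> \<in> W" "u + l - l' = \<zeta> * z"
      using e0(2)[of z "u + l - l'"] zu l' zero_in_L by (metis Diff_iff IntE ball_min_Int singletonD)
    have "u - \<zeta> * z = - (l - l')" using \<zeta>(2) by (simp add: algebra_simps)
    thus "\<exists>\<zeta>\<in>W. u - \<zeta> * z \<in> L" using \<zeta>(1) lattice_minus[OF L ll] by metis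
  qed (use e0 e1 in auto)
qed

lemma compl_fsigma: "fsigma (- L)"
proof -
  obtain C :: "nat \<Rightarrow> complex set" where "\<And>n. compact (C n)" "\<Union>(range C) = - L"
    using open_Union_compact_subsets[OF lattice_open_compl[OF L]] by metis
  thus ?thesis using fsigma.intros[of C] compact_imp_closed by metis
qed

lemma countable_fibre: "countable {z \<in> - L. S z = w}"
proof -
  have "countable {z \<in> - L. S z - w = 0}"
  proof (rule holomorphic_countable_zeros)
    show "(\<lambda>z. S z - w) holomorphic_on - L" by (intro holomorphic_intros hol)
    show "\<not> (\<lambda>z. S z - w) constant_on - L"
      using not_constant unfolding constant_on_def by (metis diff_add_cancel)
  qed (use lattice_open_compl[OF L] lattice_connected_compl[OF L] compl_fsigma in auto)
  thus ?thesis by simp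
qed

lemma countable_critical: "countable {z \<in> - L. deriv S z = 0}"
proof (cases "deriv S constant_on - L")
  case False
  show ?thesis
    by (rule holomorphic_countable_zeros[OF holomorphic_deriv[OF hol lattice_open_compl[OF L]]
          lattice_open_compl[OF L] lattice_connected_compl[OF L] compl_fsigma False])
next
  case True
  then obtain k where k: "\<And>z. z \<in> - L \<Longrightarrow> deriv S z = k" unfolding constant_on_def by blast
  \<comment> \<open>Countability of zeros says nothing about a constant derivative. But a zero
    derivative would make \<open>S\<close> constant, so in this case there are no critical points at
    all.\<close>
  have "k \<noteq> 0"
  proof
    assume "k = 0"
    hence "(S has_field_derivative 0) (at z)" if "z \<in> - L" for z
      using holomorphic_derivI[OF hol lattice_open_compl[OF L] that, of UNIV] k[OF that] by simp
    then obtain k' where "\<And>z. z \<in> - L \<Longrightarrow> S z = k'"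
      using DERIV_zero_connected_constant[OF lattice_connected_compl[OF L] lattice_open_compl[OF L], of "{}" S]
        holomorphic_on_imp_continuous_on[OF hol] by auto
    hence "S constant_on - L" unfolding constant_on_def by blast
    thus False using not_constant by blast
  qed
  hence "{z \<in> - L. deriv S z = 0} = {}" using k by auto
  thus ?thesis by (metis countable_empty)
qed

theorem fibre:
  assumes z: "z \<notin> L" and u: "u \<notin> L" and eq: "S u = S z"
  shows "\<exists>\<zeta>\<in>W. u - \<zeta> * z \<in> L"
proof (rule ccontr)
  assume neg: "\<not> (\<exists>\<zeta>\<in>W. u - \<zeta> * z \<in> L)"
  define A where "A = {z \<in> - L. \<exists>u\<in>- L. S u = S z \<and> (\<forall>\<zeta>\<in>W. u - \<zeta> * z \<notin> L)}"
  \<comment> \<open>Whole fibres through critical points are removed, not only the critical points: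
    the limit argument needs \<open>S\<close> to be injective near every preimage of
    \<open>S y\<close>, in particular near the limit \<open>u\<close>.\<close>
  define B where "B = (\<Union>v\<in>{v \<in> - L. deriv S v = 0}. {z \<in> - L. S z = S v})"
  define X where "X = - L - B"
  have zA: "z \<in> A" using z u eq neg by (auto simp: A_def)
  have "countable B" unfolding B_def
    by (rule countable_UN[OF countable_critical countable_fibre])
  hence cLB: "countable (L \<union> B)" using lattice_countable[OF L] by auto
  have X: "connected X" unfolding X_def
    by (rule connected_open_diff_countable)
       (use lattice_open_compl[OF L] lattice_connected_compl[OF L] \<open>countable B\<close> in auto)
  have opA: "open A" unfolding open_contains_ball
  proof
    fix z assume "z \<in> A"
    then obtain u where zu: "z \<notin> L" "u \<notin> L" "S u = S z" "\<And>\<zeta>. \<zeta> \<in> W \<Longrightarrow> u - \<zeta> * z \<notin> L"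
      unfolding A_def by auto
    \<comment> \<open>Being outside the orbit is an open condition on pairs, so \<open>x\<close> may
      vary in \<open>U\<close> and \<open>y\<close> in \<open>Z\<close> independently. The open
      mapping theorem then supplies an \<open>x\<close> in \<open>U\<close> with the value
      \<open>S y\<close>.\<close>
    define Q where "Q = (\<Inter>\<zeta>\<in>W. (\<lambda>p. fst p - \<zeta> * snd p) -` (- L)) \<inter> ((- L) \<times> (- L))"
    have "open (\<Inter>\<zeta>\<in>W. (\<lambda>p. fst p - \<zeta> * snd p) -` (- L))"
      by (intro open_INT W_finite ballI open_vimage lattice_open_compl[OF L] continuous_intros)
    hence "open Q" unfolding Q_def by (intro open_Int open_Times lattice_open_compl[OF L])
    moreover have "(u, z) \<in> Q" using zu by (auto simp: Q_def)
    ultimately obtain U Z where UZ: "open U" "open Z" "u \<in> U" "z \<in> Z" "U \<times> Z \<subseteq> Q"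
      by (rule open_prod_elim) auto
    have UL: "x \<notin> L" "y \<notin> L" "\<And>\<zeta>. \<zeta> \<in> W \<Longrightarrow> x - \<zeta> * y \<notin> L" if "x \<in> U" "y \<in> Z" for x y
    proof -
      have "(x, y) \<in> Q" using that UZ(5) by blast
      thus "x \<notin> L" "y \<notin> L" "\<And>\<zeta>. \<zeta> \<in> W \<Longrightarrow> x - \<zeta> * y \<notin> L" by (auto simp: Q_def)
    qed
    have opim: "open (S ` U)"
      by (rule open_mapping_thm[OF hol lattice_open_compl[OF L] lattice_connected_compl[OF L] UZ(1) _ not_constant])
         (use UL UZ in auto)
    have "isCont S z" using analytic_at_imp_isCont[OF analytic[OF zu(1)]] .
    hence "filterlim S (nhds (S z)) (nhds z)" by (simp add: isCont_def tendsto_at_iff_tendsto_nhds)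
    moreover have "S z \<in> S ` U" using UZ(3) zu(3) by (metis image_eqI)
    ultimately have "\<forall>\<^sub>F y in nhds z. S y \<in> S ` U" using opim by (metis topological_tendstoD)
    moreover have "\<forall>\<^sub>F y in nhds z. y \<in> Z" using UZ by (intro eventually_nhds_in_open)
    ultimately have "\<forall>\<^sub>F y in nhds z. y \<in> A"
    proof eventually_elim
      case (elim y)
      then obtain x where x: "x \<in> U" "S x = S y" by auto
      thus ?case unfolding A_def using UL[OF x(1) elim(2)] by auto
    qed
    thus "\<exists>e>0. ball z e \<subseteq> A" unfolding eventually_nhds_metric by (auto simp: dist_commute subset_iff)
  qed
  have closed: "\<exists>T. closed T \<and> A \<inter> X = T \<inter> X"
  proof -
    have "y \<in> A" if "y \<in> closure (A \<inter> X)" "y \<in> X" for y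
    proof -
      obtain zn where zn: "\<And>n. zn n \<in> A \<inter> X" "zn \<longlonglongrightarrow> y"
        using \<open>y \<in> closure (A \<inter> X)\<close> unfolding closure_sequential by blast
      obtain K where K: "compact K" "\<And>z. \<exists>l\<in>L. z + l \<in> K" 
        using lattice_fundamental[OF L] by blast
      \<comment> \<open>Lattice translations move the extra preimages into a compact set, so that a
        subsequence converges.\<close>
      have "\<exists>u. u \<in> K \<and> u \<notin> L \<and> S u = S (zn n) \<and> (\<forall>\<zeta>\<in>W. u - \<zeta> * zn n \<notin> L)" for n
      proof -
        obtain u where u: "u \<notin> L" "S u = S (zn n)" "\<And>\<zeta>. \<zeta> \<in> W \<Longrightarrow> u - \<zeta> * zn n \<notin> L"
          using zn(1)[of n] unfolding A_def by auto
        obtain l where l: "l \<in> L" "u + l \<in> K" using K by blast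
        have "u + l - \<zeta> * zn n = (u - \<zeta> * zn n) + l" for \<zeta> by simp
        hence "u + l - \<zeta> * zn n \<notin> L" if "\<zeta> \<in> W" for \<zeta>
          using u(3)[OF that] lattice_add_iff[OF L l(1)] by metis
        thus ?thesis using u l per[OF l(1) u(1)] lattice_add_iff[OF L l(1), of u]
          by (intro exI[of _ "u + l"]) auto
      qed
      then obtain un where un: "\<And>n. un n \<in> K" "\<And>n. un n \<notin> L" "\<And>n. S (un n) = S (zn n)"
        "\<And>n \<zeta>. \<zeta> \<in> W \<Longrightarrow> un n - \<zeta> * zn n \<notin> L" by metis
      obtain u \<sigma> where u: "u \<in> K" "strict_mono \<sigma>" "(un \<circ> \<sigma>) \<longlonglongrightarrow> u"
        using K(1) un(1) unfolding compact_def by metis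
      have z\<sigma>: "(\<lambda>n. zn (\<sigma> n)) \<longlonglongrightarrow> y" using LIMSEQ_subseq_LIMSEQ[OF zn(2) u(2)] by (simp add: o_def)
      have u\<sigma>: "(\<lambda>n. un (\<sigma> n)) \<longlonglongrightarrow> u" using u(3) by (simp add: o_def)
      have yL: "y \<notin> L" using \<open>y \<in> X\<close> by (simp add: X_def)
      have Sy: "(\<lambda>n. S (un (\<sigma> n))) \<longlonglongrightarrow> S y"
        unfolding un(3) by (rule isCont_tendsto_compose[OF analytic_at_imp_isCont[OF analytic[OF yL]] z\<sigma>])
      \<comment> \<open>At a lattice point \<open>S\<close> would tend to infinity along the
        sequence, whereas its values converge to \<open>S y\<close>.\<close>
      have uL: "u \<notin> L"
      proof
        assume uL: "u \<in> L"
        have "filterlim (\<lambda>n. un (\<sigma> n)) (at u) sequentially"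
          using u\<sigma> un(2) uL by (intro filterlim_atI) (auto intro!: always_eventually)
        hence "filterlim (\<lambda>n. S (un (\<sigma> n))) at_infinity sequentially"
          by (rule filterlim_compose[OF tends_to_infinity[OF uL]])
        thus False using Sy not_tendsto_and_filterlim_at_infinity[OF sequentially_bot] by metis
      qed
      have "(\<lambda>n. S (un (\<sigma> n))) \<longlonglongrightarrow> S u"
        by (rule isCont_tendsto_compose[OF analytic_at_imp_isCont[OF analytic[OF uL]] u\<sigma>])
      hence Suy: "S u = S y" using Sy LIMSEQ_unique by blast
      show "y \<in> A"
      proof (rule ccontr)
        assume "y \<notin> A"
        then obtain \<zeta> where \<zeta>: "\<zeta> \<in> W" "u - \<zeta> * y \<in> L"
          using yL uL Suy unfolding A_def by auto
        have "deriv S u \<noteq> 0"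
          using \<open>y \<in> X\<close> uL yL Suy unfolding X_def B_def by auto
        then obtain r where r: "r > 0" "ball u r \<subseteq> - L" "inj_on S (ball u r)"
          using has_complex_derivative_locally_injective[OF hol _ lattice_open_compl[OF L], of u] uL by auto
        \<comment> \<open>Modulo \<open>L\<close>,
          \<open>\<zeta> * zn (\<sigma> n) + (u - \<zeta> * y)\<close> is the point of the orbit of
          \<open>zn (\<sigma> n)\<close> that approaches \<open>u\<close>. It has the same value
          under \<open>S\<close> as \<open>un (\<sigma> n)\<close>, and injectivity near
          \<open>u\<close> identifies the two, against the choice of \<open>un\<close>.\<close>
        have "(\<lambda>n. \<zeta> * zn (\<sigma> n) + (u - \<zeta> * y)) \<longlonglongrightarrow> \<zeta> * y + (u - \<zeta> * y)"
          by (intro tendsto_intros z\<sigma>)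
        hence lim: "(\<lambda>n. \<zeta> * zn (\<sigma> n) + (u - \<zeta> * y)) \<longlonglongrightarrow> u" by simp
        have "\<forall>\<^sub>F n in sequentially. \<zeta> * zn (\<sigma> n) + (u - \<zeta> * y) \<in> ball u r"
          "\<forall>\<^sub>F n in sequentially. un (\<sigma> n) \<in> ball u r"
          using r(1) by (auto intro!: topological_tendstoD[OF lim] topological_tendstoD[OF u\<sigma>] simp del: mem_ball)
        hence "\<forall>\<^sub>F n in sequentially. False"
        proof eventually_elim
          case (elim n)
          have zL: "zn (\<sigma> n) \<notin> L" using zn(1) by (auto simp: A_def)
          hence "S (\<zeta> * zn (\<sigma> n) + (u - \<zeta> * y)) = S (zn (\<sigma> n))"
            using per[OF \<zeta>(2)] rot[OF \<zeta>(1)] W_mult_L_iff[OF \<zeta>(1)] by simp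
          hence "\<zeta> * zn (\<sigma> n) + (u - \<zeta> * y) = un (\<sigma> n)"
            using elim r(3) un(3) by (metis inj_onD)
          hence "un (\<sigma> n) - \<zeta> * zn (\<sigma> n) \<in> L" using \<zeta>(2) by (metis add_diff_cancel_left')
          thus False using un(4)[OF \<zeta>(1)] by blast
        qed
        thus False by simp
      qed
    qed
    moreover have "A \<inter> X \<subseteq> closure (A \<inter> X)" by (rule closure_subset)
    ultimately show ?thesis by (intro exI[of _ "closure (A \<inter> X)"]) auto
  qed
  have "A \<inter> X \<noteq> {}"
    using open_not_subset_countable[OF opA _ cLB] zA by (auto simp: X_def A_def)
  moreover have "openin (top_of_set X) (A \<inter> X)"
    using opA by (metis Int_commute openin_open_Int)
  moreover have "closedin (top_of_set X) (A \<inter> X)"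
    using closed by (metis Int_commute closedin_closed_Int)
  ultimately have "A \<inter> X = X" using X unfolding connected_clopen by metis
  obtain e where e: "e > 0" "\<And>z u. z \<in> ball 0 e - {0} \<Longrightarrow> u \<notin> L \<Longrightarrow> S z = S u \<Longrightarrow> \<exists>\<zeta>\<in>W. u - \<zeta> * z \<in> L"
    using fibre_of_small by blast
  have "\<not> ball 0 e \<subseteq> L \<union> B"
    using e(1) by (intro open_not_subset_countable cLB) auto
  then obtain x where "x \<in> ball 0 e" "x \<notin> L \<union> B" by blast
  hence x: "x \<in> ball 0 e" "x \<notin> L" "x \<notin> B" by blast+
  hence "x \<in> A" using \<open>A \<inter> X = X\<close> by (auto simp: X_def)
  then obtain u where "u \<notin> L" "S u = S x" "\<And>\<zeta>. \<zeta> \<in> W \<Longrightarrow> u - \<zeta> * x \<notin> L"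
    unfolding A_def by auto
  moreover have "x \<noteq> 0" using x(2) zero_in_L by auto
  ultimately show False using e(2)[of x u] x(1) by auto
qed

end

subsection \<open>Logarithmic derivatives\<close>

lemma analytic_at_eventually:
  assumes "f analytic_on {a}"
  shows "\<forall>\<^sub>F v in nhds a. f analytic_on {v}"
proof -
  obtain T where T: "open T" "a \<in> T" "f holomorphic_on T" using assms analytic_at by blast
  show ?thesis using eventually_nhds_in_open[OF T(1,2)]
    by eventually_elim (use T holomorphic_on_imp_analytic_at in blast)
qed

lemma higher_deriv_affine:
  assumes "f analytic_on {u * z + c}"
  shows "(deriv ^^ n) (\<lambda>w. f (u * w + c)) z = u ^ n * (deriv ^^ n) f (u * z + c)"
proof -
  obtain T where T: "open T" "u * z + c \<in> T" "f holomorphic_on T" using assms analytic_at by blast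
  have "open ((\<lambda>w. u * w + c) -` T)" by (intro open_vimage T continuous_intros)
  thus ?thesis using T
    by (intro higher_deriv_compose_linear'[OF T(3) _ T(1)]) auto
qed

lemma higher_deriv_periodic:
  assumes "f analytic_on {z + l}" "\<forall>\<^sub>F w in nhds z. f (w + l) = f w"
  shows "(deriv ^^ n) f (z + l) = (deriv ^^ n) f z"
  using higher_deriv_affine[of f 1 z l n] higher_deriv_cong_ev[OF assms(2) refl] assms(1) by simp

text \<open>The factor \<open>k\<close> contributes \<open>deriv k v / k v\<close>, analytic because
  \<open>k\<close> does not vanish at \<open>a\<close>; the pole comes from the power alone. The
  uses are \<open>n = - m\<close> at lattice points and \<open>n = 1\<close> at simple
  zeros.\<close>

lemma removable_logderiv:
  assumes k: "k analytic_on {a}" "k a \<noteq> 0"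
    and f: "\<forall>\<^sub>F v in at a. f v = k v * (v - a) powi n"
  shows "removable_at (\<lambda>v. deriv f v / f v - of_int n * (1 / (v - a))) a"
proof (rule removable_atI)
  show "(\<lambda>v. deriv k v / k v) analytic_on {a}" using k by (intro analytic_intros) auto
  have "\<forall>\<^sub>F v in at a. k v \<noteq> 0" using k by (rule analytic_at_neq_imp_eventually_neq)
  moreover have "\<forall>\<^sub>F v in at a. k analytic_on {v}"
    using analytic_at_eventually[OF k(1)] by (auto simp: eventually_at_filter elim: eventually_mono)
  moreover have "\<forall>\<^sub>F v in at a. v \<noteq> a" by (simp add: eventually_at_filter)
  moreover note eventually_at_eventually_nhds[OF f] f
  ultimately show "\<forall>\<^sub>F v in at a. deriv f v / f v - of_int n * (1 / (v - a)) = deriv k v / k v"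
  proof eventually_elim
    case (elim v)
    have va: "v - a \<noteq> 0" using elim by simp
    have "(k has_field_derivative deriv k v) (at v)" using analytic_derivI[OF elim(2)] .
    moreover have "((\<lambda>v. (v - a) powi n) has_field_derivative of_int n * (v - a) powi (n - 1) * 1) (at v)"
      using va by (intro DERIV_power_int) (auto intro!: derivative_eq_intros)
    ultimately have "((\<lambda>v. k v * (v - a) powi n) has_field_derivative
        deriv k v * (v - a) powi n + of_int n * (v - a) powi (n - 1) * 1 * k v) (at v)"
      by (rule DERIV_mult)
    hence "deriv f v = deriv k v * (v - a) powi n + of_int n * (v - a) powi (n - 1) * 1 * k v"
      using deriv_cong_ev[OF elim(4) refl] DERIV_imp_deriv by metis
    moreover have "(v - a) powi (n - 1) = (v - a) powi n / (v - a)"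
      using va by (simp add: power_int_diff)
    moreover have "K' * P + s * (P / x) * 1 * K = K * P * (K' / K + s / x)"
      if "K \<noteq> 0" "x \<noteq> 0" for K K' P s x :: complex
      using that by (simp add: field_simps)
    ultimately have "deriv f v = f v * (deriv k v / k v + of_int n / (v - a))"
      using elim(1,5) va by metis
    moreover have "f v \<noteq> 0" using elim(1,5) va by simp
    ultimately show ?case by simp
  qed
qed

lemma removable_higher_deriv_pole:
  assumes "removable_at (\<lambda>v. q v - s * (1 / (v - a))) a"
  shows "removable_at (\<lambda>v. (deriv ^^ n) q v - s * ((- 1) ^ n * fact n / (v - a) ^ Suc n)) a"
proof -
  obtain r where r: "r analytic_on {a}" "\<forall>\<^sub>F v in at a. q v - s * (1 / (v - a)) = r v"
    using assms unfolding removable_at_def by blast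
  show ?thesis
  proof (rule removable_atI)
    show "(deriv ^^ n) r analytic_on {a}" using r(1) by (rule analytic_higher_deriv)
    have "\<forall>\<^sub>F v in at a. r analytic_on {v}"
      using analytic_at_eventually[OF r(1)] by (auto simp: eventually_at_filter elim: eventually_mono)
    moreover have "\<forall>\<^sub>F v in at a. v \<noteq> a" by (simp add: eventually_at_filter)
    moreover note eventually_at_eventually_nhds[OF r(2)]
    ultimately show "\<forall>\<^sub>F v in at a. (deriv ^^ n) q v - s * ((- 1) ^ n * fact n / (v - a) ^ Suc n)
        = (deriv ^^ n) r v"
    proof eventually_elim
      case (elim v)
      have i: "(\<lambda>v. 1 / (v - a)) analytic_on {v}" using elim(2) by (auto intro!: analytic_intros)
      have "\<forall>\<^sub>F w in nhds v. q w = r w + s * (1 / (w - a))"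
        using elim(3) by eventually_elim (simp add: algebra_simps)
      hence "(deriv ^^ n) q v = (deriv ^^ n) (\<lambda>w. r w + s * (1 / (w - a))) v"
        by (rule higher_deriv_cong_ev) simp
      also have "\<dots> = (deriv ^^ n) r v + (deriv ^^ n) (\<lambda>w. s * (1 / (w - a))) v"
        by (rule higher_deriv_add_at[OF elim(1)]) (intro analytic_on_mult analytic_on_const i)
      also have "(deriv ^^ n) (\<lambda>w. s * (1 / (w - a))) v = s * ((- 1) ^ n * fact n / (v - a) ^ Suc n)"
        unfolding higher_deriv_cmult'[OF i] higher_deriv_inverse[OF elim(2)] ..
      finally show ?case by simp
    qed
  qed
qed

text \<open>The point is that the coefficients do not depend on \<open>w\<close>: the parameter
  enters through a polynomial in \<open>1 / (f v - w)\<close> without constant term. This gives both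
  the rationality of \<open>R\<close> and the vanishing of the logarithmic term as \<open>w\<close>
  tends to infinity.\<close>

lemma higher_logderiv_expansion:
  assumes f: "f holomorphic_on T" and T: "open T"
  obtains A where "\<And>v w. v \<in> T \<Longrightarrow> f v \<noteq> w \<Longrightarrow>
    (deriv ^^ n) (\<lambda>v. deriv f v / (f v - w)) v = (\<Sum>j\<in>{1..Suc n}. A j v / (f v - w) ^ j)"
proof -
  \<comment> \<open>Holomorphy of the coefficients is carried through the induction because the next
    coefficients contain their derivatives.\<close>
  have "\<exists>A. (\<forall>j. A j holomorphic_on T) \<and> (\<forall>v w. v \<in> T \<longrightarrow> f v \<noteq> w \<longrightarrow>
    (deriv ^^ n) (\<lambda>v. deriv f v / (f v - w)) v = (\<Sum>j\<in>{1..Suc n}. A j v / (f v - w) ^ j))"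
  proof (induction n)
    case 0
    show ?case
      by (rule exI[of _ "\<lambda>j. deriv f"]) (use holomorphic_deriv[OF f T] in auto)
  next
    case (Suc n)
    then obtain A where A: "\<And>j. A j holomorphic_on T" "\<And>v w. v \<in> T \<Longrightarrow> f v \<noteq> w \<Longrightarrow>
      (deriv ^^ n) (\<lambda>v. deriv f v / (f v - w)) v = (\<Sum>j\<in>{1..Suc n}. A j v / (f v - w) ^ j)" by blast
    \<comment> \<open>By the quotient rule, term \<open>j\<close> of the old sum contributes to the
      terms \<open>j\<close> and \<open>j + 1\<close> of the new one. The conditions account for the
      new top index, which has no contribution of the first kind, and for \<open>j = 1\<close>,
      which has none of the second.\<close>
    define B where "B = (\<lambda>j v. (if j \<le> Suc n then deriv (A j) v else 0)
      - (if j \<ge> 2 then of_nat (j - 1) * A (j - 1) v * deriv f v else 0))"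
    have "B j holomorphic_on T" for j
      unfolding B_def using A(1) f T
      by (cases "j \<le> Suc n"; cases "j \<ge> 2") (auto intro!: holomorphic_intros)
    moreover have "(deriv ^^ Suc n) (\<lambda>v. deriv f v / (f v - w)) v
        = (\<Sum>j\<in>{1..Suc (Suc n)}. B j v / (f v - w) ^ j)" if v: "v \<in> T" "f v \<noteq> w" for v w
    proof -
      have fv: "f analytic_on {v}" by (rule holomorphic_on_imp_analytic_at[OF f T v(1)])
      have "\<forall>\<^sub>F x in nhds v. f x \<noteq> w"
        using analytic_at_imp_isCont[OF fv] v(2)
        by (metis isCont_def tendsto_at_iff_tendsto_nhds tendsto_imp_eventually_ne)
      moreover have "\<forall>\<^sub>F x in nhds v. x \<in> T" using T v by (intro eventually_nhds_in_open)
      ultimately have "\<forall>\<^sub>F x in nhds v. (deriv ^^ n) (\<lambda>v. deriv f v / (f v - w)) x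
          = (\<Sum>j\<in>{1..Suc n}. A j x / (f x - w) ^ j)"
        by eventually_elim (rule A(2))
      from deriv_cong_ev[OF this refl]
      have 1: "(deriv ^^ Suc n) (\<lambda>v. deriv f v / (f v - w)) v
          = deriv (\<lambda>x. \<Sum>j\<in>{1..Suc n}. A j x / (f x - w) ^ j) v"
        by (simp only: funpow.simps o_apply)
      define X where "X = f v - w"
      have X0: "X \<noteq> 0" using v by (simp add: X_def)
      have d: "((\<lambda>x. A j x / (f x - w) ^ j) has_field_derivative
          deriv (A j) v / X ^ j - of_nat j * A j v * deriv f v / X ^ Suc j) (at v)"
        if j: "j \<in> {1..Suc n}" for j
      proof -
        obtain i where i: "j = Suc i" using j by (cases j) auto
        have 2: "(A j has_field_derivative deriv (A j) v) (at v)"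
          using holomorphic_derivI[OF A(1) T v(1)] .
        have "((\<lambda>x. f x - w) has_field_derivative deriv f v) (at v)"
          using holomorphic_derivI[OF f T v(1)] by (auto intro!: derivative_eq_intros)
        from DERIV_power[OF this, of j]
        have 3: "((\<lambda>x. (f x - w) ^ j) has_field_derivative of_nat j * (deriv f v * X ^ (j - 1))) (at v)"
          by (simp add: X_def)
        have "((\<lambda>x. A j x / (f x - w) ^ j) has_field_derivative
            (deriv (A j) v * X ^ j - A j v * (of_nat j * (deriv f v * X ^ (j - 1)))) / (X ^ j * X ^ j)) (at v)"
          using DERIV_divide[OF 2 3] X0 by (simp add: X_def)
        moreover have "(D * X ^ j - a * (of_nat j * (F * X ^ (j - 1)))) / (X ^ j * X ^ j)
            = D / X ^ j - of_nat j * a * F / X ^ Suc j" for D a F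
          using X0 by (simp add: i field_simps)
        ultimately show ?thesis by simp
      qed
      have "deriv (\<lambda>x. \<Sum>j\<in>{1..Suc n}. A j x / (f x - w) ^ j) v
          = (\<Sum>j\<in>{1..Suc n}. deriv (A j) v / X ^ j - of_nat j * A j v * deriv f v / X ^ Suc j)"
        by (rule DERIV_imp_deriv[OF DERIV_sum[OF d]])
      also have "\<dots> = (\<Sum>j\<in>{1..Suc n}. deriv (A j) v / X ^ j)
          - (\<Sum>j\<in>{1..Suc n}. of_nat j * A j v * deriv f v / X ^ Suc j)"
        by (rule sum_subtractf)
      also have "(\<Sum>j\<in>{1..Suc n}. deriv (A j) v / X ^ j)
          = (\<Sum>j\<in>{1..Suc (Suc n)}. (if j \<le> Suc n then deriv (A j) v else 0) / X ^ j)"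
        by (rule sum.mono_neutral_cong_left) auto
      also have "(\<Sum>j\<in>{1..Suc n}. of_nat j * A j v * deriv f v / X ^ Suc j)
          = (\<Sum>j\<in>{1..Suc (Suc n)}. (if j \<ge> 2 then of_nat (j - 1) * A (j - 1) v * deriv f v else 0) / X ^ j)"
      proof -
        have "(\<Sum>j\<in>{1..Suc n}. of_nat j * A j v * deriv f v / X ^ Suc j)
          = (\<Sum>j\<in>{Suc 1..Suc (Suc n)}. of_nat (j - 1) * A (j - 1) v * deriv f v / X ^ j)"
          by (subst sum.shift_bounds_cl_Suc_ivl) simp
        also have "\<dots> = (\<Sum>j\<in>{1..Suc (Suc n)}. (if j \<ge> 2 then of_nat (j - 1) * A (j - 1) v * deriv f v else 0) / X ^ j)"
          by (rule sum.mono_neutral_cong_left) auto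
        finally show ?thesis .
      qed
      finally show ?thesis unfolding 1
        by (simp add: B_def X_def diff_divide_distrib sum_subtractf)
    qed
    ultimately show ?case by blast
  qed
  thus ?thesis using that by blast
qed

section \<open>The identity for the logarithmic derivative of \<open>S v - S z\<close>\<close>

context rotation_elliptic
begin

definition logderiv :: "complex \<Rightarrow> complex \<Rightarrow> complex" where
  "logderiv w v = deriv S v / (S v - w)"

text \<open>For points off the lattice, \<open>fibre\<close> turns this into
  \<open>S u \<noteq> S z\<close>. The form with orbits also keeps every
  \<open>u - \<zeta> * z\<close> away from the poles of \<open>S\<close>.\<close>

definition separated :: "complex \<Rightarrow> complex \<Rightarrow> bool" where
  "separated u z \<longleftrightarrow> (\<forall>\<zeta>\<in>W. u - \<zeta> * z \<notin> L)"

text \<open>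
  For generic \<open>z\<close> the zeros of \<open>S v - S z\<close> are simple and the points \<open>\<zeta> * z\<close> are distinct modulo \<open>L\<close>.
\<close>

definition generic :: "complex \<Rightarrow> bool" where
  "generic z \<longleftrightarrow> z \<notin> L \<and> deriv S z \<noteq> 0 \<and> (\<forall>\<zeta>\<in>W. \<forall>\<xi>\<in>W. \<zeta> \<noteq> \<xi> \<longrightarrow> (\<zeta> - \<xi>) * z \<notin> L)"

lemma shift_analytic:
  assumes "a - t \<notin> L"
  shows "(\<lambda>v. S (v - t)) analytic_on {a}"
proof -
  have "(S \<circ> (\<lambda>v. v - t)) analytic_on {a}"
    by (rule analytic_on_compose) (use analytic[OF assms] in \<open>auto intro!: analytic_intros\<close>)
  thus ?thesis by (simp add: o_def)
qed

lemma separated_eventually: "\<forall>\<^sub>F v in at a. separated v z"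
  unfolding separated_def
proof (rule eventually_ball_finite[OF W_finite], rule ballI)
  fix \<zeta> assume "\<zeta> \<in> W"
  show "\<forall>\<^sub>F v in at a. v - \<zeta> * z \<notin> L"
    using eventually_at_affine[where u = 1 and c = "- \<zeta> * z" and P = "\<lambda>v. v \<notin> L" and a = a]
      lattice_eventually[OF L] by simp
qed

lemma separated_eventually': "\<forall>\<^sub>F z in at a. separated u z"
  unfolding separated_def
proof (rule eventually_ball_finite[OF W_finite], rule ballI)
  fix \<zeta> assume "\<zeta> \<in> W"
  thus "\<forall>\<^sub>F z in at a. u - \<zeta> * z \<notin> L"
    using eventually_at_affine[where u = "- \<zeta>" and c = u and P = "\<lambda>v. v \<notin> L" and a = a]
      lattice_eventually[OF L] W_nonzero
    by (simp add: add.commute)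
qed

lemma separated_neq:
  assumes "z \<notin> L" "u \<notin> L" "separated u z"
  shows "S u \<noteq> S z"
  using fibre[OF assms(1,2)] assms(3) unfolding separated_def by metis

lemma logderiv_analytic:
  assumes "a \<notin> L" "S a \<noteq> w"
  shows "logderiv w analytic_on {a}"
  unfolding logderiv_def using assms analytic[OF assms(1)]
  by (intro analytic_intros) auto

text \<open>This is the chain rule for the invariance of \<open>S\<close> under a rotation followed
  by a lattice translation. With \<open>\<zeta> = 1\<close> it makes \<open>deriv S\<close>
  periodic; in general it carries a nonzero derivative from \<open>z\<close> to its whole
  orbit.\<close>

lemma deriv_S_rot:
  assumes "\<zeta> \<in> W" "z \<notin> L" "a - \<zeta> * z \<in> L"
  shows "\<zeta> * deriv S a = deriv S z"
proof -
  have a: "\<zeta> * z + (a - \<zeta> * z) \<notin> L"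
    using assms W_mult_L_iff[OF assms(1)] lattice_add_iff[OF L assms(3)] by blast
  have "\<forall>\<^sub>F w in nhds z. w \<in> - L" using assms(2) lattice_open_compl[OF L] by (intro eventually_nhds_in_open) auto
  hence "\<forall>\<^sub>F w in nhds z. S (\<zeta> * w + (a - \<zeta> * z)) = S w"
    by eventually_elim (use per[OF assms(3)] rot[OF assms(1)] W_mult_L_iff[OF assms(1)] in auto)
  from higher_deriv_cong_ev[OF this refl, of 1] higher_deriv_affine[OF analytic[OF a], of 1]
  show ?thesis by simp
qed

lemma sign: "(- 1) ^ (m - 1) * fact (m - 1) = - c"
proof -
  obtain k where "m = Suc k" using m2 by (cases m) auto
  thus ?thesis by (simp add: c_def)
qed

text \<open>At \<open>a\<close> the function \<open>S - w\<close> has order \<open>- m\<close>, so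
  the logarithmic derivative has residue \<open>- m\<close>. By \<open>sign\<close>, another
  \<open>m - 1\<close> derivatives turn this into \<open>m * c / (v - a) ^ m\<close>, the principal
  part of \<open>m * S\<close>.\<close>

lemma logderiv_pole:
  assumes a: "a \<in> L"
  shows "removable_at (\<lambda>v. (deriv ^^ (m - 1)) (logderiv w) v - of_nat m * S v) a"
proof -
  obtain r where r: "r analytic_on {a}" "\<forall>\<^sub>F z in at a. S z - c / (z - a) ^ m = r z"
    using pole_at_lattice[OF a] unfolding removable_at_def by blast
  define k where "k = (\<lambda>v. c + (r v - w) * (v - a) ^ m)"
  have k: "k analytic_on {a}" unfolding k_def by (intro analytic_intros r)
  have "k a \<noteq> 0" using m2 c0 by (simp add: k_def power_0_left)
  have ne: "\<forall>\<^sub>F v in at a. v \<noteq> a" by (simp add: eventually_at_filter)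
  have f: "\<forall>\<^sub>F v in at a. S v - w = k v * (v - a) powi (- int m)"
    using r(2) ne
  proof eventually_elim
    case (elim v)
    have "S v - w = (r v - w) + c / (v - a) ^ m" using elim(1) by (simp add: algebra_simps)
    also have "\<dots> = k v / (v - a) ^ m" using elim(2) by (simp add: k_def field_simps)
    finally show ?case by (simp add: power_int_minus divide_inverse)
  qed
  have "removable_at (\<lambda>v. deriv (\<lambda>v. S v - w) v / (S v - w) - of_int (- int m) * (1 / (v - a))) a"
    using removable_logderiv[OF k \<open>k a \<noteq> 0\<close> f] .
  moreover have "\<forall>\<^sub>F v in at a. logderiv w v - of_int (- int m) * (1 / (v - a))
      = deriv (\<lambda>v. S v - w) v / (S v - w) - of_int (- int m) * (1 / (v - a))"
    using lattice_eventually[OF L]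
  proof eventually_elim
    case (elim v)
    have "deriv (\<lambda>v. S v - w) v = deriv S v"
      using analytic_derivI[OF analytic[OF elim], of UNIV]
      by (intro DERIV_imp_deriv) (auto intro!: derivative_eq_intros)
    thus ?case by (simp add: logderiv_def)
  qed
  ultimately have "removable_at (\<lambda>v. logderiv w v - of_int (- int m) * (1 / (v - a))) a"
    by (rule removable_at_cong)
  note removable_higher_deriv_pole[OF this, of "m - 1"]
  moreover have "of_int (- int m) * ((- 1) ^ (m - 1) * fact (m - 1) / (v - a) ^ Suc (m - 1))
      = of_nat m * (c / (v - a) ^ m)" for v
    using m2 unfolding sign by simp
  ultimately have "removable_at (\<lambda>v. (deriv ^^ (m - 1)) (logderiv w) v - of_nat m * (c / (v - a) ^ m)) a"
    by (simp only:)
  from removable_at_diff[OF this removable_at_cmult[OF pole_at_lattice[OF a], of "of_nat m"]]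
  show ?thesis by (simp add: algebra_simps)
qed

text \<open>A simple zero gives residue 1, hence by \<open>sign\<close> the principal part
  \<open>- c / (v - a) ^ m\<close>, which a single translate of \<open>S\<close> can cancel.\<close>

lemma logderiv_simple_zero:
  assumes a: "a \<notin> L" "deriv S a \<noteq> 0"
  shows "removable_at (\<lambda>v. (deriv ^^ (m - 1)) (logderiv (S a)) v + c / (v - a) ^ m) a"
proof -
  define k where "k = (\<lambda>v. if v = a then deriv S a else (S v - S a) / (v - a))"
  have "k holomorphic_on - L"
    unfolding k_def by (rule pole_lemma_open[OF hol lattice_open_compl[OF L]])
  hence k: "k analytic_on {a}"
    using a lattice_open_compl[OF L] holomorphic_on_imp_analytic_at by blast
  have "k a \<noteq> 0" using a by (simp add: k_def)
  have f: "\<forall>\<^sub>F v in at a. S v - S a = k v * (v - a) powi 1"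
    by (simp add: eventually_at_filter k_def)
  have "removable_at (\<lambda>v. deriv (\<lambda>v. S v - S a) v / (S v - S a) - of_int 1 * (1 / (v - a))) a"
    using removable_logderiv[OF k \<open>k a \<noteq> 0\<close> f] .
  moreover have "\<forall>\<^sub>F v in at a. logderiv (S a) v - 1 * (1 / (v - a))
      = deriv (\<lambda>v. S v - S a) v / (S v - S a) - of_int 1 * (1 / (v - a))"
    using lattice_eventually[OF L]
  proof eventually_elim
    case (elim v)
    have "deriv (\<lambda>v. S v - S a) v = deriv S v"
      using analytic_derivI[OF analytic[OF elim], of UNIV]
      by (intro DERIV_imp_deriv) (auto intro!: derivative_eq_intros)
    thus ?case by (simp add: logderiv_def)
  qed
  ultimately have "removable_at (\<lambda>v. logderiv (S a) v - 1 * (1 / (v - a))) a"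
    by (rule removable_at_cong)
  note removable_higher_deriv_pole[OF this, of "m - 1"]
  moreover have "1 * ((- 1) ^ (m - 1) * fact (m - 1) / (v - a) ^ Suc (m - 1)) = - (c / (v - a) ^ m)" for v
    using m2 unfolding sign by simp
  ultimately show ?thesis by (simp only: diff_minus_eq_add)
qed

lemma logderiv_periodic:
  assumes l: "l \<in> L" and v: "v \<notin> L" "S v \<noteq> w"
  shows "(deriv ^^ n) (logderiv w) (v + l) = (deriv ^^ n) (logderiv w) v"
proof (rule higher_deriv_periodic)
  show "logderiv w analytic_on {v + l}"
    using v per[OF l v(1)] lattice_add_iff[OF L l] by (intro logderiv_analytic) auto
  have "\<forall>\<^sub>F x in nhds v. x \<in> - L"
    using v lattice_open_compl[OF L] by (intro eventually_nhds_in_open) auto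
  thus "\<forall>\<^sub>F x in nhds v. logderiv w (x + l) = logderiv w x"
  proof eventually_elim
    case (elim x)
    thus ?case using per[OF l] deriv_S_rot[OF W_one, of x "x + l"] l
      by (simp add: logderiv_def)
  qed
qed

text \<open>The aim is that this vanishes. The term \<open>m * S v\<close> accounts for the poles at
  lattice points and the translates for those at the zeros \<open>\<zeta> * z\<close>. Only
  \<open>m - 1\<close> derivatives appear since \<open>logderiv\<close> already contains
  one.\<close>

definition defect :: "complex \<Rightarrow> complex \<Rightarrow> complex" where
  "defect z v = (deriv ^^ (m - 1)) (logderiv (S z)) v - of_nat m * S v + (\<Sum>\<zeta>\<in>W. S (v - \<zeta> * z))"

lemma defect_analytic:
  assumes "z \<notin> L" "a \<notin> L" "separated a z"
  shows "defect z analytic_on {a}"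
  unfolding defect_def using assms separated_neq[OF assms] unfolding separated_def
  by (intro analytic_intros logderiv_analytic analytic shift_analytic) auto

text \<open>Genericity makes each zero simple and keeps the zeros apart modulo \<open>L\<close>. At
  a point of the orbit exactly one translate is therefore singular, and its pole cancels the one of
  the logarithmic term. All singularities in \<open>v\<close> are thus removable and Liouville's
  theorem applies.\<close>

lemma defect_constant:
  assumes z: "generic z"
  obtains d where "\<And>v. v \<notin> L \<Longrightarrow> separated v z \<Longrightarrow> defect z v = d"
proof -
  have zL: "z \<notin> L" and dz: "deriv S z \<noteq> 0"
    and gen: "\<And>\<zeta> \<xi>. \<zeta> \<in> W \<Longrightarrow> \<xi> \<in> W \<Longrightarrow> \<zeta> \<noteq> \<xi> \<Longrightarrow> (\<zeta> - \<xi>) * z \<notin> L"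
    using z by (auto simp: generic_def)
  have rem: "removable_at (defect z) a" for a
  proof -
    consider "a \<notin> L" "separated a z" | "a \<in> L" | \<zeta> where "\<zeta> \<in> W" "a \<notin> L" "a - \<zeta> * z \<in> L"
      unfolding separated_def by blast
    thus ?thesis
    proof cases
      case 1
      thus ?thesis using zL by (intro removable_at_analytic defect_analytic)
    next
      case 2
      have "a - \<zeta> * z \<notin> L" if "\<zeta> \<in> W" for \<zeta>
        using zL 2 W_mult_L_iff[OF that] lattice_diff[OF L, of a "a - \<zeta> * z"] by auto
      hence "removable_at (\<lambda>v. \<Sum>\<zeta>\<in>W. S (v - \<zeta> * z)) a"
        by (intro removable_at_analytic analytic_on_sum shift_analytic) auto
      from removable_at_add[OF logderiv_pole[OF 2, of "S z"] this]
      show ?thesis unfolding defect_def[abs_def] .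
    next
      case 3
      note \<zeta> = this
      have Sa: "S a = S z"
        using S_cong[OF \<zeta>(3)] rot[OF \<zeta>(1) zL] zL W_mult_L_iff[OF \<zeta>(1)] by simp
      have da: "deriv S a \<noteq> 0" using deriv_S_rot[OF \<zeta>(1) zL \<zeta>(3)] dz by auto
      have 1: "removable_at (\<lambda>v. (deriv ^^ (m - 1)) (logderiv (S z)) v + c / (v - a) ^ m) a"
        using logderiv_simple_zero[OF \<zeta>(2) da] by (simp add: Sa)
      have "removable_at (\<lambda>v. S (1 * v + - \<zeta> * z) - c / (1 * v + - \<zeta> * z - (a - \<zeta> * z)) ^ m) a"
        by (rule removable_at_affine) (use pole_at_lattice[OF \<zeta>(3)] in auto)
      hence 2: "removable_at (\<lambda>v. S (v - \<zeta> * z) - c / (v - a) ^ m) a" by simp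
      have "a - \<xi> * z \<notin> L" if "\<xi> \<in> W - {\<zeta>}" for \<xi>
      proof
        assume "a - \<xi> * z \<in> L"
        hence "(a - \<xi> * z) - (a - \<zeta> * z) \<in> L" by (rule lattice_diff[OF L _ \<zeta>(3)])
        moreover have "(a - \<xi> * z) - (a - \<zeta> * z) = (\<zeta> - \<xi>) * z" by (simp add: algebra_simps)
        ultimately show False using gen[of \<zeta> \<xi>] that \<zeta>(1) by auto
      qed
      hence 3: "removable_at (\<lambda>v. (\<Sum>\<xi>\<in>W - {\<zeta>}. S (v - \<xi> * z)) - of_nat m * S v) a"
        using analytic[OF \<zeta>(2)]
        by (intro removable_at_analytic analytic_intros shift_analytic) auto
      have "defect z = (\<lambda>v. ((deriv ^^ (m - 1)) (logderiv (S z)) v + c / (v - a) ^ m)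
          + (S (v - \<zeta> * z) - c / (v - a) ^ m) + ((\<Sum>\<xi>\<in>W - {\<zeta>}. S (v - \<xi> * z)) - of_nat m * S v))"
        unfolding defect_def[abs_def] sum.remove[OF W_finite \<zeta>(1)] by (simp add: algebra_simps)
      thus ?thesis using removable_at_add[OF removable_at_add[OF 1 2] 3] by simp
    qed
  qed
  have per: "\<forall>\<^sub>F v in at a. defect z (v + l) = defect z v" if l: "l \<in> L" for a l
    using lattice_eventually[OF L] separated_eventually[where z = z]
  proof eventually_elim
    case (elim v)
    have "S (v + l - \<zeta> * z) = S (v - \<zeta> * z)" if "\<zeta> \<in> W" for \<zeta>
      using elim(2) that l by (intro S_cong) (auto simp: separated_def)
    thus ?case using per[OF l elim(1)] logderiv_periodic[OF l elim(1) separated_neq[OF zL elim]]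
      by (simp add: defect_def)
  qed
  obtain d where d: "\<And>a. defect z \<midarrow>a\<rightarrow> d"
    using periodic_removable_constant[OF L rem per] by blast
  show ?thesis
  proof (rule that)
    fix v assume v: "v \<notin> L" "separated v z"
    have "defect z \<midarrow>v\<rightarrow> defect z v"
      using analytic_at_imp_isCont[OF defect_analytic[OF zL v]] by (simp add: isCont_def)
    thus "defect z v = d" using d LIM_unique by blast
  qed
qed

end

context rotation_elliptic
begin

lemma generic_eventually:
  assumes a: "a \<notin> L"
  shows "\<forall>\<^sub>F z in at a. generic z"
proof -
  \<comment> \<open>One noncritical point shows that \<open>deriv S\<close> is not identically 0, so
    its zeros are isolated. It exists because the critical points are countable and the complement
    of \<open>L\<close> is not.\<close>
  obtain b where b: "b \<notin> L" "deriv S b \<noteq> 0"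
  proof -
    have "\<not> - L \<subseteq> {z \<in> - L. deriv S z = 0}"
      using a lattice_open_compl[OF L] by (intro open_not_subset_countable countable_critical) auto
    thus ?thesis using that by blast
  qed
  have "\<forall>\<^sub>F z in at a. deriv S z \<noteq> 0 \<and> z \<in> - L"
    using a b lattice_open_compl[OF L] lattice_connected_compl[OF L] holomorphic_deriv[OF hol]
    by (intro non_zero_neighbour_alt[of _ "- L" _ b]) auto
  moreover have "\<forall>\<^sub>F z in at a. \<forall>p\<in>W \<times> W. fst p \<noteq> snd p \<longrightarrow> (fst p - snd p) * z \<notin> L"
  proof (rule eventually_ball_finite, use W_finite in simp, rule ballI)
    fix p assume "p \<in> W \<times> W"
    show "\<forall>\<^sub>F z in at a. fst p \<noteq> snd p \<longrightarrow> (fst p - snd p) * z \<notin> L"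
      using eventually_at_affine[where u = "fst p - snd p" and c = 0 and P = "\<lambda>v. v \<notin> L" and a = a]
        lattice_eventually[OF L] by (cases "fst p = snd p") simp_all
  qed
  ultimately show ?thesis
    by eventually_elim (auto simp: generic_def)
qed

lemma reflect_analytic:
  assumes "u - \<zeta> * z \<notin> L"
  shows "(\<lambda>z. S (u - \<zeta> * z)) analytic_on {z}"
proof -
  have "(S \<circ> (\<lambda>z. u - \<zeta> * z)) analytic_on {z}"
    by (rule analytic_on_compose) (use analytic[OF assms] in \<open>auto intro!: analytic_intros\<close>)
  thus ?thesis by (simp add: o_def)
qed

text \<open>
  For fixed \<open>u\<close> the defect is an elliptic function of \<open>z\<close>. Its singularities at the orbit of
  \<open>u\<close> are removable because the defect does not depend on \<open>u\<close>, and it tends to \<open>0\<close> as \<open>z\<close> does.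
\<close>

theorem defect_zero:
  assumes z: "z \<notin> L" and u: "u \<notin> L" and sep: "separated u z"
  shows "defect z u = 0"
proof -
  obtain A where A: "\<And>v w. v \<in> - L \<Longrightarrow> S v \<noteq> w \<Longrightarrow>
      (deriv ^^ (m - 1)) (\<lambda>v. deriv S v / (S v - w)) v = (\<Sum>j\<in>{1..Suc (m - 1)}. A j v / (S v - w) ^ j)"
    using higher_logderiv_expansion[OF hol lattice_open_compl[OF L]] by metis
  define J where "J = {1..Suc (m - 1)}"
  \<comment> \<open>In the defect \<open>z\<close> is a parameter inside a higher derivative in
    \<open>v\<close>. After the expansion it enters only through \<open>S z\<close> and the
    translates, so analyticity and periodicity in \<open>z\<close> can be read off.\<close>
  define F where "F = (\<lambda>u z. (\<Sum>j\<in>J. A j u / (S u - S z) ^ j) - of_nat m * S u + (\<Sum>\<zeta>\<in>W. S (u - \<zeta> * z)))"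
  have F: "defect z u = F u z" if "z \<notin> L" "u \<notin> L" "separated u z" for z u
    using A[of u "S z"] that separated_neq[OF that]
    by (simp add: defect_def F_def J_def logderiv_def[abs_def])
  have F_analytic: "F u analytic_on {z}" if "z \<notin> L" "u \<notin> L" "separated u z" for z u
    unfolding F_def using that separated_neq[OF that]
    by (intro analytic_intros analytic reflect_analytic) (auto simp: separated_def)
  have F_lattice: "\<exists>g. g analytic_on {a} \<and> g a = 0 \<and> (\<forall>\<^sub>F z in at a. F u z = g z)" if a: "a \<in> L" for a
  proof -
    obtain r where r: "r analytic_on {a}" "\<forall>\<^sub>F z in at a. S z - c / (z - a) ^ m = r z"
      using pole_at_lattice[OF a] unfolding removable_at_def by blast
    \<comment> \<open>This is the analytic continuation of \<open>1 / (S u - S z)\<close> to the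
      pole \<open>a\<close> of \<open>S\<close>, obtained by clearing the denominator
      \<open>(z - a) ^ m\<close>. It vanishes at \<open>a\<close>.\<close>
    define Y where "Y = (\<lambda>z. (z - a) ^ m / ((S u - r z) * (z - a) ^ m - c))"
    have Y: "Y analytic_on {a}"
      unfolding Y_def using m2 c0 by (intro analytic_intros r) (auto simp: power_0_left)
    have Ya: "Y a = 0" using m2 by (simp add: Y_def power_0_left)
    have ua: "u - \<zeta> * a \<notin> L" if "\<zeta> \<in> W" for \<zeta>
      using u lattice_add_iff[OF L W_mult_L[OF that a], of "u - \<zeta> * a"] by simp
    define g where "g = (\<lambda>z. (\<Sum>j\<in>J. A j u * Y z ^ j) - of_nat m * S u + (\<Sum>\<zeta>\<in>W. S (u - \<zeta> * z)))"
    have "g analytic_on {a}"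
      unfolding g_def using ua by (intro analytic_intros Y reflect_analytic)
    moreover have "g a = 0"
    proof -
      \<comment> \<open>At a lattice point each of the \<open>m\<close> translates equals
        \<open>S u\<close>, and together they cancel \<open>m * S u\<close>. The remaining sum
        vanishes because its index starts at 1 and \<open>Y a = 0\<close>.\<close>
      have "S (u - \<zeta> * a) = S u" if "\<zeta> \<in> W" for \<zeta>
        using lattice_minus[OF L W_mult_L[OF that a]] u by (intro S_cong) auto
      hence "(\<Sum>\<zeta>\<in>W. S (u - \<zeta> * a)) = of_nat m * S u" by (simp add: W_card)
      moreover have "(\<Sum>j\<in>J. A j u * Y a ^ j) = 0"
        by (intro sum.neutral) (auto simp: J_def Ya power_0_left)
      ultimately show ?thesis by (simp add: g_def)
    qed
    moreover have "\<forall>\<^sub>F z in at a. z \<noteq> a" by (simp add: eventually_at_filter)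
    hence "\<forall>\<^sub>F z in at a. F u z = g z" using r(2)
    proof eventually_elim
      case (elim z)
      define t where "t = (z - a) ^ m"
      have t: "t \<noteq> 0" using elim(1) by (simp add: t_def)
      have "S u - S z = ((S u - r z) * t - c) / t"
        using t elim(2)[symmetric] by (simp add: t_def field_simps)
      hence "1 / (S u - S z) = Y z" by (simp add: Y_def t_def)
      hence "A j u / (S u - S z) ^ j = A j u * Y z ^ j" for j
        by (metis divide_inverse inverse_eq_divide power_inverse)
      thus ?case by (simp add: F_def g_def)
    qed
    ultimately show ?thesis by blast
  qed
  have rem: "removable_at (F u) a" for a
  proof -
    consider "a \<in> L" | "a \<notin> L" "separated u a" | "a \<notin> L" "\<not> separated u a" by blast
    thus ?thesis
    proof cases
      case 1
      thus ?thesis using F_lattice removable_at_def by blast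
    next
      case 2
      thus ?thesis using F_analytic u removable_at_analytic by blast
    next
      case 3
      have "\<forall>\<^sub>F v in at 0. v \<notin> L \<and> separated v a"
        using lattice_eventually[OF L] separated_eventually[where z = a] by eventually_elim simp
      \<comment> \<open>The singularity at \<open>a\<close> is an effect of \<open>u\<close> lying
        in its orbit. \<open>F u2\<close> is analytic at \<open>a\<close> and agrees with
        \<open>F u\<close> at the generic points nearby.\<close>
      then obtain u2 where u2: "u2 \<notin> L" "separated u2 a"
        using eventually_happens'[OF at_neq_bot] by blast
      have "\<forall>\<^sub>F z in at a. F u z = F u2 z"
        using generic_eventually[OF 3(1)] separated_eventually'[where u = u] separated_eventually'[where u = u2]
      proof eventually_elim
        case (elim z)
        have zL: "z \<notin> L" using elim(1) by (simp add: generic_def)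
        obtain d where "\<And>v. v \<notin> L \<Longrightarrow> separated v z \<Longrightarrow> defect z v = d"
          using defect_constant[OF elim(1)] by blast
        thus ?case using F[OF zL u elim(2)] F[OF zL u2(1) elim(3)] u u2 elim by metis
      qed
      thus ?thesis using F_analytic[OF 3(1) u2] by (rule removable_atI[rotated])
    qed
  qed
  have per: "\<forall>\<^sub>F z in at a. F u (z + l) = F u z" if l: "l \<in> L" for a l
    using lattice_eventually[OF L] separated_eventually'[where u = u]
  proof eventually_elim
    case (elim z)
    have "S (u - \<zeta> * (z + l)) = S (u - \<zeta> * z)" if "\<zeta> \<in> W" for \<zeta>
      using elim(2) that lattice_minus[OF L W_mult_L[OF that l]]
      by (intro S_cong) (auto simp: separated_def algebra_simps)
    thus ?case using per[OF l elim(1)] by (simp add: F_def)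
  qed
  obtain d where d: "\<And>a. F u \<midarrow>a\<rightarrow> d"
    using periodic_removable_constant[OF L rem per] by blast
  have "d = 0"
  proof -
    obtain g where g: "g analytic_on {0}" "g 0 = 0" "\<forall>\<^sub>F z in at 0. F u z = g z"
      using F_lattice[OF zero_in_L] by blast
    have "g \<midarrow>0\<rightarrow> 0" using analytic_at_imp_isCont[OF g(1)] g(2) by (simp add: isCont_def)
    hence "F u \<midarrow>0\<rightarrow> 0" using g(3) by (subst tendsto_cong)
    thus ?thesis using d LIM_unique by blast
  qed
  moreover have "F u \<midarrow>z\<rightarrow> F u z"
    using analytic_at_imp_isCont[OF F_analytic[OF z u sep]] by (simp add: isCont_def)
  ultimately show ?thesis using d F[OF z u sep] LIM_unique by metis
qed

end

section \<open>Derivatives of the local branch of the logarithm, and constant terms\<close>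

lemma higher_deriv_log_near:
  assumes f: "f analytic_on {u}" and u: "f u \<noteq> 0"
  shows "(deriv ^^ Suc n) (log_near f u) u = (deriv ^^ n) (\<lambda>v. deriv f v / f v) u"
proof -
  have cont: "filterlim f (nhds (f u)) (nhds u)"
    using analytic_at_imp_isCont[OF f] by (simp add: isCont_def tendsto_at_iff_tendsto_nhds)
  \<comment> \<open>The quotient is 1 at \<open>u\<close>, so near \<open>u\<close> it stays off the
    branch cut of \<open>Ln\<close> wherever \<open>f u\<close> lies.\<close>
  hence "filterlim (\<lambda>v. f v / f u) (nhds (f u / f u)) (nhds u)" by (intro tendsto_intros u)
  moreover have "open (- \<real>\<^sub>\<le>\<^sub>0 :: complex set)" by auto
  moreover have "f u / f u \<in> - \<real>\<^sub>\<le>\<^sub>0" using u by simp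
  ultimately have "\<forall>\<^sub>F v in nhds u. f v / f u \<in> - \<real>\<^sub>\<le>\<^sub>0" by (rule topological_tendstoD)
  hence "\<forall>\<^sub>F v in nhds u. deriv (log_near f u) v = deriv f v / f v"
    using analytic_at_eventually[OF f]
  proof eventually_elim
    case (elim v)
    hence "f v \<noteq> 0" by auto
    have "((\<lambda>v. f v / f u) has_field_derivative deriv f v / f u) (at v)"
      by (rule DERIV_cdivide[OF analytic_derivI[OF elim(2)]])
    hence "((\<lambda>v. Ln (f v / f u)) has_field_derivative inverse (f v / f u) * (deriv f v / f u)) (at v)"
      using elim(1) by (intro DERIV_chain2[OF has_field_derivative_Ln]) auto
    hence "(log_near f u has_field_derivative 0 + inverse (f v / f u) * (deriv f v / f u)) (at v)"
      unfolding log_near_def[abs_def] by (intro DERIV_add DERIV_const)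
    thus ?case using DERIV_imp_deriv u \<open>f v \<noteq> 0\<close> by (fastforce simp: field_simps)
  qed
  from higher_deriv_cong_ev[OF this refl] show ?thesis by (simp only: funpow_Suc_right o_apply)
qed

context rotation_elliptic
begin

text \<open>The term \<open>c / z ^ m\<close> only has the Laurent index \<open>- m\<close>, so the
  coefficient at index 0 is the value of the regular part at 0. As a limit it can be compared for
  the two lattices.\<close>

lemma constant_term_limit: "(\<lambda>z. S z - c / z ^ m) \<midarrow>0\<rightarrow> constant_term S"
proof -
  obtain r where r: "r analytic_on {0}" "\<forall>\<^sub>F z in at 0. S z - c / z ^ m = r z"
    using pole unfolding removable_at_def by blast
  have "(\<lambda>z. c * z powi (- int m) + r z) has_laurent_expansion
      fls_const c * fls_shift (- (- int m)) 1 + fps_to_fls (fps_expansion r 0)"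
    by (intro has_laurent_expansion_add has_laurent_expansion_cmult_left
        has_laurent_expansion_fps_X_power_int has_laurent_expansion_fps
        analytic_at_imp_has_fps_expansion_0 r)
  moreover have "\<forall>\<^sub>F z in at 0. S z = c * z powi (- int m) + r z"
    using r(2) by eventually_elim (simp add: power_int_minus divide_inverse algebra_simps)
  ultimately have "S has_laurent_expansion
      fls_const c * fls_shift (- (- int m)) 1 + fps_to_fls (fps_expansion r 0)"
    using has_laurent_expansion_cong[OF _ refl] by fastforce
  hence "laurent_expansion S 0 = fls_const c * fls_shift (- (- int m)) 1 + fps_to_fls (fps_expansion r 0)"
    by (intro laurent_expansion_eqI) simp
  hence "constant_term S = r 0"
    using m2 by (simp add: constant_term_def fps_expansion_def)
  moreover have "r \<midarrow>0\<rightarrow> r 0" using analytic_at_imp_isCont[OF r(1)] by (simp add: isCont_def)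
  ultimately show ?thesis using r(2) by (simp add: tendsto_cong)
qed

lemma deriv_log_near:
  assumes "u \<notin> L" "S u \<noteq> w"
  shows "(deriv ^^ m) (log_near (\<lambda>v. S v - w) u) u = (deriv ^^ (m - 1)) (logderiv w) u"
proof -
  have a: "(\<lambda>v. S v - w) analytic_on {u}" by (intro analytic_intros analytic assms)
  have "(deriv ^^ Suc (m - 1)) (log_near (\<lambda>v. S v - w) u) u
      = (deriv ^^ (m - 1)) (\<lambda>v. deriv (\<lambda>v. S v - w) v / (S v - w)) u"
    using assms by (intro higher_deriv_log_near a) simp
  also have "\<dots> = (deriv ^^ (m - 1)) (logderiv w) u"
  proof (rule higher_deriv_cong_ev[OF _ refl])
    show "\<forall>\<^sub>F v in nhds u. deriv (\<lambda>v. S v - w) v / (S v - w) = logderiv w v"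
      using analytic_at_eventually[OF analytic[OF assms(1)]]
    proof eventually_elim
      case (elim v)
      have "deriv (\<lambda>v. S v - w) v = deriv S v"
        using analytic_derivI[OF elim, of UNIV]
        by (intro DERIV_imp_deriv) (auto intro!: derivative_eq_intros)
      thus ?case by (simp add: logderiv_def)
    qed
  qed
  finally show ?thesis using m2 by simp
qed

text \<open>This is \<open>defect_zero\<close> times \<open>(- 1) ^ (m + 1)\<close>. Parity turns
  \<open>(- 1) ^ m * S (u - \<zeta> * z)\<close> into \<open>S (\<zeta> * z - u)\<close>, and
  rotating back by \<open>\<zeta>\<close> into \<open>S (z - inverse \<zeta> * u)\<close>. The
  \<open>m\<close> copies of \<open>S u\<close> become the values of these translates at
  \<open>z = 0\<close>.\<close>

lemma deriv_log_near_orbit_sum: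
  assumes "z \<notin> L" "u \<notin> L" "separated u z"
  shows "(- 1) ^ (m + 1) * (deriv ^^ m) (log_near (\<lambda>v. S v - S z) u) u
      = (\<Sum>\<zeta>\<in>W. S (z - \<zeta> * u) - S (- (\<zeta> * u)))"
proof -
  have notin: "\<zeta> * z - u \<notin> L" if "\<zeta> \<in> W" for \<zeta>
    using assms(3) that lattice_diff_commute[OF L] unfolding separated_def by blast
  have 1: "(deriv ^^ m) (log_near (\<lambda>v. S v - S z) u) u = of_nat m * S u - (\<Sum>\<zeta>\<in>W. S (u - \<zeta> * z))"
    using defect_zero[OF assms]
    unfolding defect_def deriv_log_near[OF assms(2) separated_neq[OF assms], symmetric]
    by (simp add: algebra_simps)
  have 2: "S (- (\<zeta> * u)) = (- 1) ^ m * S u" if "\<zeta> \<in> W" for \<zeta>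
    using parity[of "\<zeta> * u"] rot[OF that assms(2)] W_mult_L_iff[OF that] assms(2) by simp
  have 3: "(- 1) ^ m * S (u - \<zeta> * z) = S (z - inverse \<zeta> * u)" if \<zeta>: "\<zeta> \<in> W" for \<zeta>
  proof -
    have e: "\<zeta> * z - u = \<zeta> * (z - inverse \<zeta> * u)" using W_nonzero[OF \<zeta>] by (simp add: algebra_simps)
    have "z - inverse \<zeta> * u \<notin> L" using notin[OF \<zeta>] W_mult_L_iff[OF \<zeta>] unfolding e by blast
    hence "S (\<zeta> * z - u) = S (z - inverse \<zeta> * u)" unfolding e by (rule rot[OF \<zeta>])
    moreover have "S (u - \<zeta> * z) = (- 1) ^ m * S (\<zeta> * z - u)"
      using parity[OF notin[OF \<zeta>]] by simp
    moreover have "(- 1) ^ m * ((- 1) ^ m * s) = s" for s :: complex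
      by (simp flip: mult.assoc power_mult_distrib)
    ultimately show ?thesis by simp
  qed
  have "(\<Sum>\<zeta>\<in>W. (- 1) ^ m * S (u - \<zeta> * z)) = (\<Sum>\<zeta>\<in>W. S (z - inverse \<zeta> * u))"
    using 3 by (rule sum.cong[OF refl])
  also have "\<dots> = (\<Sum>\<zeta>\<in>W. S (z - \<zeta> * u))"
    by (rule sum.reindex_bij_witness[where i = inverse and j = inverse]) (auto intro: W_inverse)
  finally have "(- 1) ^ m * (\<Sum>\<zeta>\<in>W. S (u - \<zeta> * z)) = (\<Sum>\<zeta>\<in>W. S (z - \<zeta> * u))"
    by (simp add: sum_distrib_left)
  moreover have "(\<Sum>\<zeta>\<in>W. S (- (\<zeta> * u))) = of_nat m * ((- 1) ^ m * S u)"
    using 2 by (simp add: W_card)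
  ultimately show ?thesis unfolding 1 by (simp add: sum_subtractf algebra_simps)
qed

end

subsection \<open>The function of a sublattice\<close>

lemma lattice_coset_iff: "x \<in> lattice_coset L u \<longleftrightarrow> x - u \<in> L"
  by (auto simp: lattice_coset_def image_iff intro: bexI[of _ "x - u"])

lemma lattice_coset_eq_iff:
  assumes "is_lattice L"
  shows "lattice_coset L u = lattice_coset L v \<longleftrightarrow> u - v \<in> L"
proof
  assume "lattice_coset L u = lattice_coset L v"
  moreover have "u \<in> lattice_coset L u" by (simp add: lattice_coset_iff lattice_0[OF assms])
  ultimately show "u - v \<in> L" by (simp add: lattice_coset_iff)
next
  assume uv: "u - v \<in> L"
  have "x - u \<in> L \<longleftrightarrow> x - v \<in> L" for x
    using lattice_add_iff[OF assms uv, of "x - u"] by simp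
  thus "lattice_coset L u = lattice_coset L v" by (auto simp: lattice_coset_iff)
qed

text \<open>The two functions share the leading coefficient \<open>c\<close>. Hence the pole of
  \<open>S'\<close> at each point of \<open>L'\<close> cancels against that of exactly one translate
  of \<open>S\<close>.\<close>

locale rotation_elliptic_pair =
  A: rotation_elliptic W L m S c + B: rotation_elliptic W L' m S' c
  for W L L' :: "complex set" and m :: nat and S S' :: "complex \<Rightarrow> complex" and c :: complex +
  assumes sub: "L \<subseteq> L'" and fin: "finite (lattice_coset L ` L')"
begin

definition nonzero_cosets :: "complex set set" where
  "nonzero_cosets = lattice_coset L ` (L' - L)"

definition coset_rep :: "complex set \<Rightarrow> complex" where
  "coset_rep C = (SOME x. x \<in> C)"

lemma coset_rep: "coset_rep (lattice_coset L u) - u \<in> L"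
proof -
  have "u \<in> lattice_coset L u" by (simp add: lattice_coset_iff A.zero_in_L)
  hence "coset_rep (lattice_coset L u) \<in> lattice_coset L u"
    unfolding coset_rep_def by (rule someI)
  thus ?thesis by (simp add: lattice_coset_iff)
qed

lemma coset_rep_nonzero:
  assumes "C \<in> nonzero_cosets"
  shows "coset_rep C \<in> L' - L" "lattice_coset L (coset_rep C) = C"
proof -
  obtain u where u: "u \<in> L' - L" "C = lattice_coset L u" using assms by (auto simp: nonzero_cosets_def)
  note d = coset_rep[of u, folded u(2)]
  have "coset_rep C = (coset_rep C - u) + u" by simp
  thus "coset_rep C \<in> L' - L"
    using u(1) d sub lattice_add[OF B.L, of "coset_rep C - u" u] lattice_add_iff[OF A.L d, of u]
    by (auto simp: add.commute)
  show "lattice_coset L (coset_rep C) = C" using d u(2) lattice_coset_eq_iff[OF A.L] by simp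
qed

lemma finite_nonzero_cosets: "finite nonzero_cosets"
  unfolding nonzero_cosets_def using fin by (rule finite_subset[rotated]) auto

text \<open>Subtracting all translates of \<open>S\<close> from \<open>S'\<close> leaves an
  \<open>L\<close>-periodic function without poles, hence a constant. It is evaluated at 0, where
  \<open>S'\<close> and \<open>S\<close> leave their constant terms and every other translate its
  value \<open>S (- coset_rep C)\<close>.\<close>

theorem translation_sum:
  assumes z: "z \<notin> L'"
  shows "S' z = S z + (\<Sum>C\<in>nonzero_cosets. S (z - coset_rep C) - S (- coset_rep C))
      + constant_term S' - constant_term S"
proof -
  define H where "H = (\<lambda>z. S' z - S z - (\<Sum>C\<in>nonzero_cosets. S (z - coset_rep C)))"
  have notin: "a - coset_rep C \<notin> L" if "a \<notin> L'" "C \<in> nonzero_cosets" for a C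
    using that coset_rep_nonzero[OF that(2)] sub lattice_add[OF B.L, of "a - coset_rep C" "coset_rep C"] by auto
  have an: "H analytic_on {a}" if "a \<notin> L'" for a
    unfolding H_def using that sub notin[OF that]
    by (intro analytic_intros A.analytic B.analytic A.shift_analytic) auto
  have rem: "removable_at H a" for a
  proof (cases "a \<in> L'")
    case False
    thus ?thesis by (intro removable_at_analytic an)
  next
    case a: True
    note S' = B.pole_at_lattice[OF a]
    show ?thesis
    proof (cases "a \<in> L")
      case True
      have "a - coset_rep C \<notin> L" if "C \<in> nonzero_cosets" for C
        using coset_rep_nonzero(1)[OF that] lattice_diff[OF A.L True, of "a - coset_rep C"] by auto
      hence "removable_at (\<lambda>z. \<Sum>C\<in>nonzero_cosets. S (z - coset_rep C)) a"
        by (intro removable_at_analytic analytic_on_sum A.shift_analytic) auto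
      from removable_at_diff[OF removable_at_diff[OF S' A.pole_at_lattice[OF True]] this]
      show ?thesis by (simp add: H_def)
    next
      case False
      \<comment> \<open>The translate belonging to the coset of \<open>a\<close> is the only one
        that is singular at \<open>a\<close>.\<close>
      define C0 where "C0 = lattice_coset L a"
      have C0: "C0 \<in> nonzero_cosets" using a False by (auto simp: C0_def nonzero_cosets_def)
      have aL: "a - coset_rep C0 \<in> L"
        using coset_rep[of a] lattice_diff_commute[OF A.L] by (simp add: C0_def)
      have "removable_at (\<lambda>z. S (1 * z + - coset_rep C0) - c / (1 * z + - coset_rep C0 - (a - coset_rep C0)) ^ m) a"
        by (rule removable_at_affine) (use A.pole_at_lattice[OF aL] in auto)
      hence S0: "removable_at (\<lambda>z. S (z - coset_rep C0) - c / (z - a) ^ m) a" by simp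
      have "a - coset_rep C \<notin> L" if "C \<in> nonzero_cosets - {C0}" for C
        using that coset_rep_nonzero(2)[of C] lattice_coset_eq_iff[OF A.L, of a "coset_rep C"]
        by (auto simp: C0_def)
      hence rest: "removable_at (\<lambda>z. S z + (\<Sum>C\<in>nonzero_cosets - {C0}. S (z - coset_rep C))) a"
        using A.analytic[OF False]
        by (intro removable_at_analytic analytic_on_add analytic_on_sum A.shift_analytic) auto
      have "H = (\<lambda>z. (S' z - c / (z - a) ^ m) - (S (z - coset_rep C0) - c / (z - a) ^ m)
          - (S z + (\<Sum>C\<in>nonzero_cosets - {C0}. S (z - coset_rep C))))"
        unfolding H_def sum.remove[OF finite_nonzero_cosets C0] by (simp add: algebra_simps)
      thus ?thesis using removable_at_diff[OF removable_at_diff[OF S' S0] rest] by simp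
    qed
  qed
  have per: "\<forall>\<^sub>F z in at a. H (z + l) = H z" if l: "l \<in> L" for a l
    using lattice_eventually[OF B.L]
  proof eventually_elim
    case (elim z)
    have "S (z + l - coset_rep C) = S (z - coset_rep C)" if "C \<in> nonzero_cosets" for C
      using notin[OF elim that] l by (intro A.S_cong) auto
    moreover have "S' (z + l) = S' z" "S (z + l) = S z"
      using elim l sub by (auto intro!: A.per B.per)
    ultimately show ?case by (simp add: H_def)
  qed
  obtain d where d: "\<And>a. H \<midarrow>a\<rightarrow> d"
    using periodic_removable_constant[OF A.L rem per] by blast
  have "H \<midarrow>z\<rightarrow> H z" using analytic_at_imp_isCont[OF an[OF z]] by (simp add: isCont_def)
  hence Hz: "H z = d" using d LIM_unique by blast
  have "(\<lambda>z. (S' z - c / z ^ m) - (S z - c / z ^ m) - (\<Sum>C\<in>nonzero_cosets. S (z - coset_rep C)))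
      \<midarrow>0\<rightarrow> constant_term S' - constant_term S - (\<Sum>C\<in>nonzero_cosets. S (0 - coset_rep C))"
  proof (intro tendsto_diff tendsto_sum A.constant_term_limit B.constant_term_limit)
    fix C assume "C \<in> nonzero_cosets"
    hence "0 - coset_rep C \<notin> L" using coset_rep_nonzero(1) lattice_minus_iff[OF A.L] by auto
    thus "(\<lambda>z. S (z - coset_rep C)) \<midarrow>0\<rightarrow> S (0 - coset_rep C)"
      using analytic_at_imp_isCont[OF A.shift_analytic[of 0]] unfolding isCont_def by blast
  qed
  hence "H \<midarrow>0\<rightarrow> constant_term S' - constant_term S - (\<Sum>C\<in>nonzero_cosets. S (0 - coset_rep C))"
    by (simp add: H_def[abs_def])
  hence "d = constant_term S' - constant_term S - (\<Sum>C\<in>nonzero_cosets. S (0 - coset_rep C))"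
    using d LIM_unique by blast
  with Hz show ?thesis by (simp add: H_def sum_subtractf algebra_simps)
qed

section \<open>Grouping the nonzero cosets into orbits of \<open>W\<close>\<close>

lemma orbit_class_cong:
  assumes \<zeta>: "\<zeta> \<in> W" "v - \<zeta> * u \<in> L"
  shows "orbit_class W L v = orbit_class W L u"
proof -
  have sub: "orbit_class W L v \<subseteq> orbit_class W L u"
    if \<zeta>: "\<zeta> \<in> W" "v - \<zeta> * u \<in> L" for \<zeta> u v
  proof
    fix x assume "x \<in> orbit_class W L v"
    then obtain \<xi> where \<xi>: "\<xi> \<in> W" "x - \<xi> * v \<in> L" by (auto simp: orbit_class_def lattice_coset_iff)
    have "x - (\<xi> * \<zeta>) * u = (x - \<xi> * v) + \<xi> * (v - \<zeta> * u)" by (simp add: algebra_simps)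
    also have "\<dots> \<in> L" using \<xi> \<zeta> by (intro lattice_add A.L A.W_mult_L)
    finally show "x \<in> orbit_class W L u"
      using A.W_mult[OF \<xi>(1) \<zeta>(1)] by (auto simp: orbit_class_def lattice_coset_iff)
  qed
  have "u - inverse \<zeta> * v = - (inverse \<zeta> * (v - \<zeta> * u))"
    using A.W_nonzero[OF \<zeta>(1)] by (simp add: algebra_simps)
  also have "\<dots> \<in> L" using \<zeta> by (intro lattice_minus A.L A.W_mult_L A.W_inverse)
  finally show ?thesis using sub[OF \<zeta>] sub[OF A.W_inverse[OF \<zeta>(1)]] by blast
qed

lemma orbit_rep:
  assumes A: "A \<in> nonzero_orbits W L L'" and x: "x \<in> A"
  shows "x \<in> L' - L" "A = orbit_class W L x"
proof -
  obtain u where u: "u \<in> L' - L" "A = orbit_class W L u" using A by (auto simp: nonzero_orbits_def)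
  then obtain \<zeta> where \<zeta>: "\<zeta> \<in> W" "x - \<zeta> * u \<in> L"
    using x by (auto simp: orbit_class_def lattice_coset_iff)
  have "\<zeta> * u \<in> L' - L" using u \<zeta>(1) A.W_mult_L_iff B.W_mult_L by auto
  moreover have "x = (x - \<zeta> * u) + \<zeta> * u" by simp
  ultimately show "x \<in> L' - L"
    using \<zeta>(2) sub lattice_add[OF B.L, of "x - \<zeta> * u" "\<zeta> * u"]
      lattice_diff[OF A.L, of x "x - \<zeta> * u"] by auto
  show "A = orbit_class W L x" using orbit_class_cong[OF \<zeta>] u(2) by simp
qed

text \<open>This is orbit counting: the map from \<open>\<zeta>\<close> to the coset of
  \<open>\<zeta> * u\<close> has the cosets of the stabilizer as fibres, so the sum over
  \<open>W\<close> meets each coset of the orbit as often as the stabilizer has elements. The weight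
  in \<open>R_fun\<close> compensates for this.\<close>

lemma orbit_sum:
  assumes rep: "\<And>A. A \<in> nonzero_orbits W L L' \<Longrightarrow> rep A \<in> A"
    and per: "\<And>x y. x \<in> L' - L \<Longrightarrow> x - y \<in> L \<Longrightarrow> \<phi> x = \<phi> y"
  shows "(\<Sum>A\<in>nonzero_orbits W L L'. (\<Sum>\<zeta>\<in>W. \<phi> (\<zeta> * rep A)) /
      of_nat (card (class_stabilizer W L (rep A)))) = (\<Sum>C\<in>nonzero_cosets. \<phi> (coset_rep C) :: complex)"
proof -
  define orb where "orb = (\<lambda>A. (\<lambda>\<zeta>. lattice_coset L (\<zeta> * rep A)) ` W)"
  have rep': "rep A \<in> L' - L" "A = orbit_class W L (rep A)" if "A \<in> nonzero_orbits W L L'" for A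
    using orbit_rep[OF that rep[OF that]] by blast+
  have W_rep: "\<zeta> * rep A \<in> L' - L" if "A \<in> nonzero_orbits W L L'" "\<zeta> \<in> W" for A \<zeta>
    using rep'(1)[OF that(1)] A.W_mult_L_iff[OF that(2)] B.W_mult_L[OF that(2)] by auto
  have 1: "(\<Sum>\<zeta>\<in>W. \<phi> (\<zeta> * rep A)) / of_nat (card (class_stabilizer W L (rep A)))
      = (\<Sum>C\<in>orb A. \<phi> (coset_rep C))" if A: "A \<in> nonzero_orbits W L L'" for A
  proof -
    define u where "u = rep A"
    have fibre_card: "card {\<zeta> \<in> W. lattice_coset L (\<zeta> * u) = C} = card (class_stabilizer W L u)"
      if C: "C \<in> orb A" for C
    proof -
      obtain \<zeta>0 where \<zeta>0: "\<zeta>0 \<in> W" "C = lattice_coset L (\<zeta>0 * u)"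
        using C unfolding orb_def u_def by blast
      have iff: "\<zeta>0 * \<xi> * u - \<zeta>0 * u \<in> L \<longleftrightarrow> \<xi> * u - u \<in> L" for \<xi>
        using A.W_mult_L_iff[OF \<zeta>0(1), of "\<xi> * u - u"] by (simp add: algebra_simps)
      have "bij_betw ((*) \<zeta>0) (class_stabilizer W L u) {\<zeta> \<in> W. lattice_coset L (\<zeta> * u) = C}"
      proof (rule bij_betwI[where g = "(*) (inverse \<zeta>0)"])
        show "(*) \<zeta>0 \<in> class_stabilizer W L u \<rightarrow> {\<zeta> \<in> W. lattice_coset L (\<zeta> * u) = C}"
          using \<zeta>0 iff A.W_mult by (auto simp: class_stabilizer_def lattice_coset_eq_iff[OF A.L])
        show "(*) (inverse \<zeta>0) \<in> {\<zeta> \<in> W. lattice_coset L (\<zeta> * u) = C} \<rightarrow> class_stabilizer W L u"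
        proof
          fix \<zeta> assume \<zeta>: "\<zeta> \<in> {\<zeta> \<in> W. lattice_coset L (\<zeta> * u) = C}"
          moreover have "\<zeta>0 * (inverse \<zeta>0 * \<zeta>) = \<zeta>" using A.W_nonzero[OF \<zeta>0(1)] by simp
          ultimately have "\<zeta>0 * (inverse \<zeta>0 * \<zeta>) * u - \<zeta>0 * u \<in> L"
            using \<zeta>0 by (simp only: mem_Collect_eq lattice_coset_eq_iff[OF A.L])
          thus "inverse \<zeta>0 * \<zeta> \<in> class_stabilizer W L u"
            using iff \<zeta> A.W_mult[OF A.W_inverse[OF \<zeta>0(1)]]
            by (auto simp: class_stabilizer_def lattice_coset_eq_iff[OF A.L])
        qed
      qed (use A.W_nonzero[OF \<zeta>0(1)] in auto)
      from bij_betw_same_card[OF this] show ?thesis by simp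
    qed
    have "finite (class_stabilizer W L u)" "1 \<in> class_stabilizer W L u"
      using A.W_finite A.W_one by (auto simp: class_stabilizer_def)
    hence pos: "card (class_stabilizer W L u) \<noteq> 0" by auto
    have "(\<Sum>\<zeta>\<in>W. \<phi> (\<zeta> * u)) = (\<Sum>C\<in>orb A. \<Sum>\<zeta>\<in>{\<zeta> \<in> W. lattice_coset L (\<zeta> * u) = C}. \<phi> (\<zeta> * u))"
      unfolding orb_def u_def by (rule sum.image_gen[OF A.W_finite])
    also have "\<dots> = (\<Sum>C\<in>orb A. \<Sum>\<zeta>\<in>{\<zeta> \<in> W. lattice_coset L (\<zeta> * u) = C}. \<phi> (coset_rep C))"
    proof (intro sum.cong refl)
      fix C \<zeta> assume \<zeta>: "\<zeta> \<in> {\<zeta> \<in> W. lattice_coset L (\<zeta> * u) = C}"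
      hence "\<zeta> * u - coset_rep C \<in> L"
        using coset_rep[of "\<zeta> * u"] lattice_diff_commute[OF A.L] by auto
      thus "\<phi> (\<zeta> * u) = \<phi> (coset_rep C)" using W_rep[OF A] \<zeta> by (intro per) (auto simp: u_def)
    qed
    also have "\<dots> = of_nat (card (class_stabilizer W L u)) * (\<Sum>C\<in>orb A. \<phi> (coset_rep C))"
      by (simp add: fibre_card sum_distrib_left)
    finally show ?thesis using pos by (simp add: u_def)
  qed
  have union: "(\<Union>A\<in>nonzero_orbits W L L'. orb A) = nonzero_cosets"
  proof
    show "(\<Union>A\<in>nonzero_orbits W L L'. orb A) \<subseteq> nonzero_cosets"
      using W_rep by (auto simp: orb_def nonzero_cosets_def)
    show "nonzero_cosets \<subseteq> (\<Union>A\<in>nonzero_orbits W L L'. orb A)"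
    proof
      fix C assume "C \<in> nonzero_cosets"
      then obtain x where x: "x \<in> L' - L" "C = lattice_coset L x" by (auto simp: nonzero_cosets_def)
      define A where "A = orbit_class W L x"
      have A: "A \<in> nonzero_orbits W L L'" using x by (auto simp: A_def nonzero_orbits_def)
      have "x \<in> orbit_class W L x"
        using A.W_one A.zero_in_L by (auto simp: orbit_class_def lattice_coset_iff intro!: bexI[of _ 1])
      hence "x \<in> orbit_class W L (rep A)" using rep'(2)[OF A] by (simp add: A_def)
      then obtain \<zeta> where "\<zeta> \<in> W" "x - \<zeta> * rep A \<in> L" by (auto simp: orbit_class_def lattice_coset_iff)
      hence "C \<in> orb A" using x(2) lattice_coset_eq_iff[OF A.L] by (auto simp: orb_def)
      thus "C \<in> (\<Union>A\<in>nonzero_orbits W L L'. orb A)" using A by blast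
    qed
  qed
  have disj: "A = B" if A: "A \<in> nonzero_orbits W L L'" and B: "B \<in> nonzero_orbits W L L'"
    and ne: "orb A \<inter> orb B \<noteq> {}" for A B
  proof -
    obtain \<zeta> \<xi> where "\<zeta> \<in> W" "\<xi> \<in> W" "lattice_coset L (\<zeta> * rep A) = lattice_coset L (\<xi> * rep B)"
      using ne by (auto simp: orb_def)
    hence *: "\<zeta> \<in> W" "\<xi> \<in> W" "\<zeta> * rep A - \<xi> * rep B \<in> L" by (auto simp: lattice_coset_eq_iff[OF A.L])
    have "orbit_class W L (rep A) = orbit_class W L (\<zeta> * rep A)"
      using orbit_class_cong[OF *(1), of "\<zeta> * rep A" "rep A"] A.zero_in_L by simp
    also have "\<dots> = orbit_class W L (rep B)" by (rule orbit_class_cong[OF *(2,3)])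
    finally show ?thesis using rep'(2)[OF A] rep'(2)[OF B] by simp
  qed
  have fin_orb: "finite (nonzero_orbits W L L')"
  proof (rule finite_subset)
    show "nonzero_orbits W L L' \<subseteq> (\<lambda>C. orbit_class W L (coset_rep C)) ` nonzero_cosets"
    proof
      fix A assume "A \<in> nonzero_orbits W L L'"
      then obtain u where u: "u \<in> L' - L" "A = orbit_class W L u" by (auto simp: nonzero_orbits_def)
      have "A = orbit_class W L (coset_rep (lattice_coset L u))"
        using orbit_class_cong[OF A.W_one, of "coset_rep (lattice_coset L u)" u] coset_rep[of u] u(2) by simp
      thus "A \<in> (\<lambda>C. orbit_class W L (coset_rep C)) ` nonzero_cosets"
        using u(1) by (auto simp: nonzero_cosets_def)
    qed
  qed (use finite_nonzero_cosets in auto)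
  have "(\<Sum>A\<in>nonzero_orbits W L L'. (\<Sum>\<zeta>\<in>W. \<phi> (\<zeta> * rep A)) / of_nat (card (class_stabilizer W L (rep A))))
      = (\<Sum>A\<in>nonzero_orbits W L L'. \<Sum>C\<in>orb A. \<phi> (coset_rep C))"
    by (intro sum.cong refl 1)
  also have "\<dots> = (\<Sum>C\<in>(\<Union>A\<in>nonzero_orbits W L L'. orb A). \<phi> (coset_rep C))"
    using fin_orb A.W_finite disj by (intro sum.UNION_disjoint[symmetric]) (auto simp: orb_def)
  finally show ?thesis unfolding union .
qed

end

subsection \<open>Rational functions with prescribed poles\<close>

text \<open>A set \<open>B\<close> fixed in advance to contain the poles makes closure under sums
  immediate: denominators multiply and stay nonzero outside \<open>B\<close> without any
  reduction.\<close>

definition rational_off :: "complex set \<Rightarrow> (complex \<Rightarrow> complex) \<Rightarrow> bool" where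
  "rational_off B F \<longleftrightarrow> (\<exists>P Q :: complex poly. Q \<noteq> 0 \<and>
    (\<forall>w. w \<notin> B \<longrightarrow> poly Q w \<noteq> 0 \<and> F w = poly P w / poly Q w))"

lemma rational_offI:
  assumes "Q \<noteq> 0" "\<And>w. w \<notin> B \<Longrightarrow> poly Q w \<noteq> 0" "\<And>w. w \<notin> B \<Longrightarrow> F w = poly P w / poly Q w"
  shows "rational_off B F"
  using assms unfolding rational_off_def by blast

lemma rational_off_poly: "rational_off B (poly P)"
  by (rule rational_offI[of 1 _ _ P]) auto

lemma rational_off_cong: "rational_off B F \<Longrightarrow> (\<And>w. w \<notin> B \<Longrightarrow> G w = F w) \<Longrightarrow> rational_off B G"
  unfolding rational_off_def by metis

lemma rational_off_add:
  assumes "rational_off B F" "rational_off B G"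
  shows "rational_off B (\<lambda>w. F w + G w)"
proof -
  obtain P Q where 1: "Q \<noteq> 0" "\<And>w. w \<notin> B \<Longrightarrow> poly Q w \<noteq> 0 \<and> F w = poly P w / poly Q w"
    using assms(1) unfolding rational_off_def by blast
  obtain P' Q' where 2: "Q' \<noteq> 0" "\<And>w. w \<notin> B \<Longrightarrow> poly Q' w \<noteq> 0 \<and> G w = poly P' w / poly Q' w"
    using assms(2) unfolding rational_off_def by blast
  show ?thesis
    by (rule rational_offI[of "Q * Q'" _ _ "P * Q' + P' * Q"]) (use 1 2 in \<open>auto simp: add_frac_eq\<close>)
qed

lemma rational_off_cmult:
  assumes "rational_off B F"
  shows "rational_off B (\<lambda>w. k * F w)"
proof -
  obtain P Q where 1: "Q \<noteq> 0" "\<And>w. w \<notin> B \<Longrightarrow> poly Q w \<noteq> 0 \<and> F w = poly P w / poly Q w"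
    using assms(1) unfolding rational_off_def by blast
  show ?thesis by (rule rational_offI[of Q _ _ "smult k P"]) (use 1 in auto)
qed

lemma rational_off_sum:
  assumes "\<And>i. i \<in> I \<Longrightarrow> rational_off B (F i)"
  shows "rational_off B (\<lambda>w. \<Sum>i\<in>I. F i w)"
proof -
  have "rational_off B (\<lambda>w. 0)" using rational_off_poly[of B 0] by (rule rational_off_cong) simp
  thus ?thesis using assms
    by (induction I rule: infinite_finite_induct) (simp_all add: rational_off_add)
qed

lemma rational_off_principal_part:
  assumes "s \<in> B"
  shows "rational_off B (\<lambda>w. a / (s - w) ^ j)"
proof (rule rational_offI[of "[:s, - 1:] ^ j" _ _ "[:a:]"])
  fix w assume "w \<notin> B"
  thus "poly ([:s, - 1:] ^ j) w \<noteq> 0" using assms by (auto simp: poly_power)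
qed (auto simp: poly_power)

lemma (in rotation_elliptic) rational_deriv_log_near:
  assumes u: "u \<notin> L" "S u \<in> B"
  shows "rational_off B (\<lambda>w. (deriv ^^ m) (log_near (\<lambda>v. S v - w) u) u)"
proof -
  obtain A where A: "\<And>v w. v \<in> - L \<Longrightarrow> S v \<noteq> w \<Longrightarrow>
      (deriv ^^ (m - 1)) (\<lambda>v. deriv S v / (S v - w)) v = (\<Sum>j\<in>{1..Suc (m - 1)}. A j v / (S v - w) ^ j)"
    using higher_logderiv_expansion[OF hol lattice_open_compl[OF L]] by metis
  have "rational_off B (\<lambda>w. \<Sum>j\<in>{1..Suc (m - 1)}. A j u / (S u - w) ^ j)"
    by (intro rational_off_sum rational_off_principal_part u)
  thus ?thesis
  proof (rule rational_off_cong)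
    fix w assume "w \<notin> B"
    hence w: "S u \<noteq> w" using u by auto
    show "(deriv ^^ m) (log_near (\<lambda>v. S v - w) u) u = (\<Sum>j\<in>{1..Suc (m - 1)}. A j u / (S u - w) ^ j)"
      using A[of u w] u w deriv_log_near[OF u(1) w] by (simp add: logderiv_def[abs_def])
  qed
qed

subsection \<open>Derivatives of the Weierstrass function\<close>

lemma S_fun_rotation_elliptic:
  assumes L: "is_lattice L" and m2: "m \<ge> 2" and W: "W = {\<zeta>. \<zeta> ^ m = 1}"
    and inv: "invariant_under W L"
  shows "rotation_elliptic W L m (S_fun W L) ((- 1) ^ m * fact (m - 1))"
proof -
  define n where "n = m - 2"
  have mn: "m = n + 2" using m2 by (simp add: n_def)
  define P where "P = weierstrass_p L"
  have card: "card W = m" using m2 card_roots_unity_eq[of m] by (simp add: W)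
  have S: "S_fun W L = (deriv ^^ n) P" by (simp add: S_fun_def card n_def P_def)
  have an: "P analytic_on {z}" if "z \<notin> L" for z
    unfolding P_def using weierstrass_p_analytic(1)[OF L that] .
  have open_nhds: "\<forall>\<^sub>F w in nhds z. w \<notin> L" if "z \<notin> L" for z
    using eventually_nhds_in_open[OF lattice_open_compl[OF L], of z] that by simp
  \<comment> \<open>The factor \<open>u ^ n\<close> of the chain rule and the \<open>u ^ 2\<close>
    of the Weierstrass function combine to \<open>u ^ m\<close>. Elements of \<open>W\<close> thus
    leave \<open>S_fun W L\<close> unchanged, and \<open>u = - 1\<close> gives the parity.\<close>
  have homothety: "u ^ m * (deriv ^^ n) P (u * z) = (deriv ^^ n) P z"
    if u: "u \<noteq> 0" "(*) u ` L = L" and z: "z \<notin> L" for u z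
  proof -
    have "u * z \<notin> L"
    proof
      assume "u * z \<in> L"
      then obtain l where "l \<in> L" "u * z = u * l" using u(2) by (metis imageE)
      thus False using z u(1) by simp
    qed
    hence "u ^ n * (deriv ^^ n) P (u * z) = (deriv ^^ n) (\<lambda>w. P (u * w)) z"
      using higher_deriv_affine[of P u z 0 n] an by simp
    also have "(\<lambda>w. P (u * w)) = (\<lambda>w. (1 / u ^ 2) * P w)"
      using weierstrass_p_homothety[OF u] by (simp add: P_def)
    also have "(deriv ^^ n) (\<lambda>w. (1 / u ^ 2) * P w) z = (1 / u ^ 2) * (deriv ^^ n) P z"
      by (rule higher_deriv_cmult'[OF an[OF z]])
    finally have "u ^ n * (deriv ^^ n) P (u * z) * u ^ 2 = (deriv ^^ n) P z"
      using u(1) by simp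
    thus ?thesis by (simp only: mn power_add mult.assoc mult.commute mult.left_commute)
  qed
  show ?thesis
  proof
    show "is_lattice L" "2 \<le> m" "W = {\<zeta>. \<zeta> ^ m = 1}" "invariant_under W L" by fact+
    show "(- 1) ^ m * fact (m - 1) = (- 1) ^ m * (fact (m - 1) :: complex)" ..
    show "S_fun W L holomorphic_on - L"
      unfolding S P_def
      by (rule holomorphic_higher_deriv[OF weierstrass_p_holomorphic[OF L] lattice_open_compl[OF L]])
    show "S_fun W L (z + l) = S_fun W L z" if "l \<in> L" "z \<notin> L" for l z
      unfolding S
    proof (rule higher_deriv_periodic)
      show "P analytic_on {z + l}" using that lattice_add_iff[OF L] by (intro an) auto
      show "\<forall>\<^sub>F w in nhds z. P (w + l) = P w"
        using open_nhds[OF that(2)]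
        by eventually_elim (simp add: P_def weierstrass_p_periodic[OF L that(1)])
    qed
    show "S_fun W L (\<zeta> * z) = S_fun W L z" if \<zeta>: "\<zeta> \<in> W" and z: "z \<notin> L" for \<zeta> z
    proof -
      have \<zeta>0: "\<zeta> \<noteq> 0" and \<zeta>m: "\<zeta> ^ m = 1" using \<zeta> m2 by (auto simp: W power_0_left)
      have L': "x \<in> L \<Longrightarrow> \<zeta> * x \<in> L" "x \<in> L \<Longrightarrow> inverse \<zeta> * x \<in> L" for x
        using inv \<zeta>m by (auto simp: invariant_under_def W power_inverse)
      have "(*) \<zeta> ` L = L"
      proof
        show "L \<subseteq> (*) \<zeta> ` L"
        proof
          fix x assume "x \<in> L"
          thus "x \<in> (*) \<zeta> ` L" using L'(2) \<zeta>0 by (intro image_eqI[of _ _ "inverse \<zeta> * x"]) auto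
        qed
      qed (use L' in auto)
      from homothety[OF \<zeta>0 this z] show ?thesis by (simp add: S \<zeta>m)
    qed
    show "S_fun W L (- z) = (- 1) ^ m * S_fun W L z" if z: "z \<notin> L" for z
    proof -
      have "(*) (- 1) ` L = L"
        using lattice_minus_iff[OF L] by (auto simp: image_iff) (metis minus_minus)
      from homothety[OF _ this z] have "(- 1) ^ m * S_fun W L (- z) = S_fun W L z" by (simp add: S)
      moreover have "(- 1) ^ m * ((- 1) ^ m * s) = s" for s :: complex
        by (simp flip: mult.assoc power_mult_distrib)
      ultimately show ?thesis by metis
    qed
    show "removable_at (\<lambda>z. S_fun W L z - (- 1) ^ m * fact (m - 1) / z ^ m) 0"
    proof -
      have "removable_at ((deriv ^^ n) (\<lambda>z. P z - 1 / z ^ 2)) 0"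
        using weierstrass_p_removable[OF L] unfolding P_def by (rule removable_at_higher_deriv)
      moreover have "\<forall>\<^sub>F z in at 0. S_fun W L z - (- 1) ^ m * fact (m - 1) / z ^ m
          = (deriv ^^ n) (\<lambda>z. P z - 1 / z ^ 2) z"
        using lattice_eventually[OF L]
      proof eventually_elim
        case (elim z)
        have z0: "z \<noteq> 0" using elim lattice_0[OF L] by auto
        have i: "(\<lambda>v. 1 / (v - 0)) analytic_on {z}" using z0 by (auto intro!: analytic_intros)
        have "\<forall>\<^sub>F v in nhds z. v \<in> - {0}" using z0 by (intro eventually_nhds_in_open) auto
        \<comment> \<open>Writing \<open>1 / v ^ 2\<close> as minus the derivative of
          \<open>1 / v\<close> reduces its derivative of order \<open>n\<close> to the one of order
          \<open>n + 1 = m - 1\<close> of \<open>1 / v\<close>; the extra minus sign turns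
          \<open>(- 1) ^ (m - 1)\<close> into the \<open>(- 1) ^ m\<close> of
          \<open>c\<close>.\<close>
        hence "\<forall>\<^sub>F v in nhds z. 1 / v ^ 2 = - 1 * deriv (\<lambda>v. 1 / (v - 0)) v"
          by eventually_elim
             (use higher_deriv_inverse[of _ 0 1] in \<open>auto simp: power2_eq_square\<close>)
        hence "(deriv ^^ n) (\<lambda>v. 1 / v ^ 2) z = (deriv ^^ n) (\<lambda>v. - 1 * deriv (\<lambda>v. 1 / (v - 0)) v) z"
          by (rule higher_deriv_cong_ev) simp
        also have "\<dots> = - 1 * (deriv ^^ n) (deriv (\<lambda>v. 1 / (v - 0))) z"
          by (rule higher_deriv_cmult'[OF analytic_deriv[OF i]])
        also have "(deriv ^^ n) (deriv (\<lambda>v. 1 / (v - 0))) z = (deriv ^^ Suc n) (\<lambda>v. 1 / (v - 0)) z"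
          by (simp only: funpow_Suc_right o_apply)
        also have "\<dots> = (- 1) ^ Suc n * fact (Suc n) / (z - 0) ^ Suc (Suc n)"
          by (rule higher_deriv_inverse[OF z0])
        finally have "(deriv ^^ n) (\<lambda>v. 1 / v ^ 2) z = (- 1) ^ m * fact (m - 1) / z ^ m"
          by (simp add: mn)
        moreover have "(deriv ^^ n) (\<lambda>z. P z - 1 / z ^ 2) z = (deriv ^^ n) P z - (deriv ^^ n) (\<lambda>v. 1 / v ^ 2) z"
          using z0 by (intro higher_deriv_diff_at an elim) (auto intro!: analytic_intros)
        ultimately show ?case by (simp add: S)
      qed
      ultimately show ?thesis by (rule removable_at_cong)
    qed
  qed
qed

theorem mainTheorem9:
  fixes W L L' :: "complex set" and m p :: nat
    and rep :: "complex set \<Rightarrow> complex"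
  assumes m: "m \<in> {2, 3, 4, 6}" and W: "W = {\<zeta>. \<zeta> ^ m = 1}"
    and p: "prime p"
    and lattices: "is_lattice L" "is_lattice L'" "L \<subseteq> L'"
    and index: "lattice_index L L' = p"
    and invariant: "invariant_under W L" "invariant_under W L'"
    and rep: "\<And>A. A \<in> nonzero_orbits W L L' \<Longrightarrow> rep A \<in> A"
  shows "(\<exists>P Q :: complex poly. Q \<noteq> 0 \<and>
           (\<forall>w. w \<notin> S_fun W L ` (L' - L) \<longrightarrow>
              poly Q w \<noteq> 0 \<and> R_fun W L L' rep w = poly P w / poly Q w)) \<and>
         (\<forall>z. z \<notin> L' \<longrightarrow>
           S_fun W L z \<notin> S_fun W L ` (L' - L) \<and>
           S_fun W L' z = R_fun W L L' rep (S_fun W L z))"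
proof -
  have m2: "m \<ge> 2" using m by auto
  \<comment> \<open>Infinite sets have cardinality 0 by convention, so a positive index gives
    finiteness.\<close>
  have "card (lattice_coset L ` L') > 0"
    using index prime_gt_0_nat[OF p] by (simp add: lattice_index_def)
  hence fin: "finite (lattice_coset L ` L')" by (rule card_ge_0_finite)
  interpret rotation_elliptic_pair W L L' m "S_fun W L" "S_fun W L'" "(- 1) ^ m * fact (m - 1)"
    using S_fun_rotation_elliptic[OF lattices(1) m2 W invariant(1)]
      S_fun_rotation_elliptic[OF lattices(2) m2 W invariant(2)] lattices(3) fin
    by (simp add: rotation_elliptic_pair_def rotation_elliptic_pair_axioms_def)
  define B where "B = S_fun W L ` (L' - L)"
  have rep_in: "rep A \<in> L' - L" if "A \<in> nonzero_orbits W L L'" for A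
    by (rule orbit_rep(1)[OF that rep[OF that]])
  have "rational_off B (\<lambda>w. (deriv ^^ m) (log_near (\<lambda>v. S_fun W L v - w) (rep A)) (rep A))"
    if "A \<in> nonzero_orbits W L L'" for A
    using rep_in[OF that] by (intro A.rational_deriv_log_near) (auto simp: B_def)
  hence "rational_off B (\<lambda>w. (- 1) ^ (m + 1) * (\<Sum>A\<in>nonzero_orbits W L L'.
      1 / of_nat (card (class_stabilizer W L (rep A))) *
      (deriv ^^ m) (log_near (\<lambda>v. S_fun W L v - w) (rep A)) (rep A))
      + poly [:constant_term (S_fun W L') - constant_term (S_fun W L), 1:] w)"
    by (intro rational_off_add rational_off_cmult rational_off_sum rational_off_poly)
  hence rational: "rational_off B (R_fun W L L' rep)"
    by (rule rational_off_cong) (simp add: R_fun_def A.W_card)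
  have "S_fun W L z \<notin> B \<and> S_fun W L' z = R_fun W L L' rep (S_fun W L z)" if z: "z \<notin> L'" for z
  proof -
    have zL: "z \<notin> L" using z lattices(3) by auto
    \<comment> \<open>A difference \<open>u - \<zeta> * z\<close> in \<open>L\<close> would put
      \<open>\<zeta> * z\<close>, and hence \<open>z\<close>, into \<open>L'\<close>.\<close>
    have sep: "A.separated u z" if "u \<in> L' - L" for u
    proof -
      have "u - \<zeta> * z \<notin> L" if "\<zeta> \<in> W" for \<zeta>
      proof
        assume "u - \<zeta> * z \<in> L"
        hence "u - (u - \<zeta> * z) \<in> L'"
          using \<open>u \<in> L' - L\<close> lattices(3) lattice_diff[OF lattices(2), of u "u - \<zeta> * z"] by blast
        thus False using z B.W_mult_L_iff[OF that] by simp
      qed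
      thus ?thesis by (simp add: A.separated_def)
    qed
    have notB: "S_fun W L z \<notin> B"
      using A.separated_neq[OF zL _ sep] by (force simp: B_def)
    \<comment> \<open>For fixed \<open>z\<close> this depends only on the nonzero class of
      \<open>x\<close> modulo \<open>L\<close>. It is the common summand of
      \<open>deriv_log_near_orbit_sum\<close>, which sums over \<open>W\<close>, and of
      \<open>translation_sum\<close>, which sums over cosets; \<open>orbit_sum\<close> links the
      two.\<close>
    define \<phi> where "\<phi> = (\<lambda>x. S_fun W L (z - x) - S_fun W L (- x))"
    have \<phi>_per: "\<phi> x = \<phi> y" if "x \<in> L' - L" "x - y \<in> L" for x y
    proof -
      have yx: "y - x \<in> L" using that(2) lattice_diff_commute[OF lattices(1)] by blast
      have y: "y \<in> L' - L"
        using that lattices lattice_diff[OF lattices(2), of x "x - y"] lattice_add_iff[OF lattices(1) that(2), of y]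
        by auto
      have "z - y \<notin> L" using z y lattices(3) lattice_add[OF lattices(2), of "z - y" y] by auto
      moreover have "- y \<notin> L" using y lattice_minus_iff[OF lattices(1)] by auto
      ultimately show ?thesis unfolding \<phi>_def
        using A.S_cong[of "z - x" "z - y"] A.S_cong[of "- x" "- y"] yx by simp
    qed
    have "R_fun W L L' rep (S_fun W L z) = (\<Sum>A\<in>nonzero_orbits W L L'.
        (- 1) ^ (m + 1) * (deriv ^^ m) (log_near (\<lambda>v. S_fun W L v - S_fun W L z) (rep A)) (rep A) /
        of_nat (card (class_stabilizer W L (rep A))))
        + S_fun W L z + constant_term (S_fun W L') - constant_term (S_fun W L)"
      by (simp only: R_fun_def A.W_card sum_distrib_left times_divide_eq_right)
    also have "(\<Sum>A\<in>nonzero_orbits W L L'.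
        (- 1) ^ (m + 1) * (deriv ^^ m) (log_near (\<lambda>v. S_fun W L v - S_fun W L z) (rep A)) (rep A) /
        of_nat (card (class_stabilizer W L (rep A))))
        = (\<Sum>A\<in>nonzero_orbits W L L'. (\<Sum>\<zeta>\<in>W. \<phi> (\<zeta> * rep A)) /
          of_nat (card (class_stabilizer W L (rep A))))"
    proof (intro sum.cong refl)
      fix A assume "A \<in> nonzero_orbits W L L'"
      hence u: "rep A \<in> L' - L" by (rule rep_in)
      show "(- 1) ^ (m + 1) * (deriv ^^ m) (log_near (\<lambda>v. S_fun W L v - S_fun W L z) (rep A)) (rep A) /
        of_nat (card (class_stabilizer W L (rep A)))
        = (\<Sum>\<zeta>\<in>W. \<phi> (\<zeta> * rep A)) / of_nat (card (class_stabilizer W L (rep A)))"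
        using A.deriv_log_near_orbit_sum[OF zL _ sep[OF u]] u by (simp add: \<phi>_def)
    qed
    also have "\<dots> = (\<Sum>C\<in>nonzero_cosets. \<phi> (coset_rep C))"
      by (rule orbit_sum[OF rep \<phi>_per])
    also have "\<dots> + S_fun W L z = S_fun W L z + (\<Sum>C\<in>nonzero_cosets. \<phi> (coset_rep C))"
      by (rule add.commute)
    finally show ?thesis using notB translation_sum[OF z] by (simp only: \<phi>_def) blast
  qed
  thus ?thesis using rational unfolding rational_off_def B_def by blast
qed

end
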